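(* Let $E>0$, let $N\ge 1$ be an integer, and let $(v,w)$ be a Grinevich--Zakharov pair with parameters $N$, $(\lambda_j)_{j=1}^{4N}$, $(\gamma_j)_{j=1}^{4N}$ (as defined in the context). Then $(v,w)$ admits a representation $$v(x,t)=V(x-ct),\qquad w(x,t)=W(x-ct),\qquad x\in\mathbb{R}^2,\ t\in\mathbb{R},$$ for some functions $V,W$ on $\mathbb{R}^2$ and some $c\in\mathbb{R}^2$ (and so is a travel wave solution of the Novikov--Veselov equation) if and only if $N=1$. In addition, when $N=1$, the travel wave velocity $c=(c_1,c_2)$, identified with $c_1+ic_2\in\mathbb{C}$, is given by $$c=6E\left(\bar\lambda^2+\frac{1}{\lambda^2}+\frac{\lambda^2}{\bar\lambda^2}\right),$$ where $\lambda$ is any of $\lambda_j$, $j=1,2,3,4$; by the relations imposed on the parameters, any one of the $\lambda_j$ determines uniquely the set $\{\lambda_1,\lambda_2,\lambda_3,\lambda_4\}$.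
   Context: Notation: $x=(x_1,x_2)\in\mathbb{R}^2$, $z=x_1+ix_2$, $\bar z=x_1-ix_2$, $\partial_z=\frac12(\partial_{x_1}-i\partial_{x_2})$, $\partial_{\bar z}=\frac12(\partial_{x_1}+i\partial_{x_2})$. Vectors $c=(c_1,c_2)\in\mathbb{R}^2$ are identified with $c_1+ic_2\in\mathbb{C}$. Novikov--Veselov equation at energy $E$: $\partial_t v=4\,\mathrm{Re}\left(4\partial_z^3v+\partial_z(vw)-E\,\partial_z w\right)$, $\partial_{\bar z}w=-3\partial_z v$, $v=\bar v$, where $v=v(x,t)$ is real-valued and sufficiently regular and decaying as $|x|\to\infty$, and $w=w(x,t)$ decays as $|x|\to\infty$. A solution $(v,w)$ is called a travel wave with velocity $c\in\mathbb{R}^2$ if $v(x,t)=V(x-ct)$, $w(x,t)=W(x-ct)$ for all $x\in\mathbb{R}^2$, $t\in\mathbb{R}$, for some functions $V,W$ on $\mathbb{R}^2$. Grinevich--Zakharov pair: fix $E>0$ (with $E^{1/2}>0$) and an integer $N\ge1$. Let $\lambda_1,\dots,\lambda_{4N},\gamma_1,\dots,\gamma_{4N}\in\mathbb{C}$ satisfy: $\lambda_j\ne0$ and $|\lambda_j|\ne1$ for $j=1,\dots,4N$; $\lambda_l\neq\lambda_m$ for $l\ne m$; $\lambda_{2j}=-\lambda_{2j-1}$ and $\gamma_{2j-1}-\gamma_{2j}=1/\lambda_{2j-1}$ for $j=1,\dots,2N$; $\lambda_{4j-1}=1/\overline{\lambda}_{4j-3}$ and $\gamma_{4j-1}=\bar\lambda_{4j-3}^2\,\bar\gamma_{4j-3}$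 for $j=1,\dots,N$. Let $A=(A_{lm})$ be the $4N\times4N$ matrix $$A_{ll}=\frac{iE^{1/2}}{2}\left(\bar z-\frac{z}{\lambda_l^2}\right)-3iE^{3/2}t\left(\lambda_l^2-\frac{1}{\lambda_l^4}\right)-\gamma_l,\qquad A_{lm}=\frac{1}{\lambda_l-\lambda_m}\ (l\ne m).$$ The pair with these parameters is $$v(x,t)=-4\,\partial_z\partial_{\bar z}\ln\det A,\qquad w(x,t)=12\,\partial_z^2\ln\det A.$$ It is known that $v$ is real-valued, that $v,w$ are smooth rational functions on $\mathbb{R}^2\times\mathbb{R}$ that are $O(|x|^{-2})$ as $|x|\to\infty$ for each $t$, and that $(v,w)$ solves the Novikov--Veselov equation at energy $E$. *)

theory Defs
  imports "HOL-Analysis.Analysis" "Jordan_Normal_Form.Determinant"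
begin

no_notation Matrix.vec_index (infixl "$" 100)

definition zc :: "real ^ 2 \<Rightarrow> complex" where
  "zc x = Complex (x $ 1) (x $ 2)"

definition partial_x :: "2 \<Rightarrow> (real ^ 2 \<Rightarrow> complex) \<Rightarrow> real ^ 2 \<Rightarrow> complex" where
  "partial_x k f x = vector_derivative (\<lambda>s. f (x + s *\<^sub>R axis k 1)) (at 0)"

definition d_z :: "(real ^ 2 \<Rightarrow> complex) \<Rightarrow> real ^ 2 \<Rightarrow> complex" where
  "d_z f x = (partial_x 1 f x - \<i> * partial_x 2 f x) / 2"

definition d_zbar :: "(real ^ 2 \<Rightarrow> complex) \<Rightarrow> real ^ 2 \<Rightarrow> complex" where
  "d_zbar f x = (partial_x 1 f x + \<i> * partial_x 2 f x) / 2"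

primrec C_k :: "nat \<Rightarrow> ('a::euclidean_space \<Rightarrow> 'b::real_normed_vector) \<Rightarrow> bool" where
  "C_k 0 f \<longleftrightarrow> continuous_on UNIV f"
| "C_k (Suc k) f \<longleftrightarrow> (\<forall>y. f differentiable (at y)) \<and>
     (\<forall>b\<in>Basis. C_k k (\<lambda>y. frechet_derivative f (at y) b))"

text \<open>The regularity required of solutions below is infinite differentiability jointly in space and time.\<close>

definition smooth :: "('a::euclidean_space \<Rightarrow> 'b::real_normed_vector) \<Rightarrow> bool" where
  "smooth f \<longleftrightarrow> (\<forall>k. C_k k f)"

text \<open>The unknown \<open>v\<close> is complex-valued here; that it is real is the equation \<open>v = cnj v\<close> of the system.\<close>

definition NV_solution ::
  "real \<Rightarrow> (real ^ 2 \<Rightarrow> real \<Rightarrow> complex) \<Rightarrow> (real ^ 2 \<Rightarrow> real \<Rightarrow> complex) \<Rightarrow> bool" where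
  "NV_solution E v w \<longleftrightarrow>
     smooth (\<lambda>(x, t). v x t) \<and> smooth (\<lambda>(x, t). w x t) \<and>
     (\<forall>t. ((\<lambda>x. v x t) \<longlongrightarrow> 0) at_infinity) \<and>
     (\<forall>t. ((\<lambda>x. w x t) \<longlongrightarrow> 0) at_infinity) \<and>
     (\<forall>x t. vector_derivative (\<lambda>s. v x s) (at t) =
        of_real (4 * Re (4 * d_z (d_z (d_z (\<lambda>y. v y t))) x
                         + d_z (\<lambda>y. v y t * w y t) x
                         - of_real E * d_z (\<lambda>y. w y t) x))) \<and>
     (\<forall>x t. d_zbar (\<lambda>y. w y t) x = - 3 * d_z (\<lambda>y. v y t) x) \<and>
     (\<forall>x t. v x t = cnj (v x t))"

definition travels_with ::
  "(real ^ 2 \<Rightarrow> real \<Rightarrow> complex) \<Rightarrow> (real ^ 2 \<Rightarrow> real \<Rightarrow> complex) \<Rightarrow> real ^ 2 \<Rightarrow> bool" where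
  "travels_with v w c \<longleftrightarrow>
     (\<exists>V W. \<forall>x t. v x t = V (x - t *\<^sub>R c) \<and> w x t = W (x - t *\<^sub>R c))"

definition NV_travel_wave ::
  "real \<Rightarrow> (real ^ 2 \<Rightarrow> real \<Rightarrow> complex) \<Rightarrow> (real ^ 2 \<Rightarrow> real \<Rightarrow> complex) \<Rightarrow> real ^ 2 \<Rightarrow> bool" where
  "NV_travel_wave E v w c \<longleftrightarrow> NV_solution E v w \<and> travels_with v w c"

definition GZ_params :: "nat \<Rightarrow> (nat \<Rightarrow> complex) \<Rightarrow> (nat \<Rightarrow> complex) \<Rightarrow> bool" where
  "GZ_params N lam gam \<longleftrightarrow>
     (\<forall>j\<in>{1..4*N}. lam j \<noteq> 0 \<and> cmod (lam j) \<noteq> 1) \<and>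
     (\<forall>l\<in>{1..4*N}. \<forall>m\<in>{1..4*N}. l \<noteq> m \<longrightarrow> lam l \<noteq> lam m) \<and>
     (\<forall>j\<in>{1..2*N}. lam (2*j) = - lam (2*j - 1) \<and>
                    gam (2*j - 1) - gam (2*j) = 1 / lam (2*j - 1)) \<and>
     (\<forall>j\<in>{1..N}. lam (4*j - 1) = 1 / cnj (lam (4*j - 3)) \<and>
                  gam (4*j - 1) = (cnj (lam (4*j - 3)))\<^sup>2 * cnj (gam (4*j - 3)))"

definition GZ_entry ::
  "real \<Rightarrow> (nat \<Rightarrow> complex) \<Rightarrow> (nat \<Rightarrow> complex) \<Rightarrow> real ^ 2 \<Rightarrow> real \<Rightarrow> nat \<Rightarrow> nat \<Rightarrow> complex" where
  "GZ_entry E lam gam x t l m =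
     (if l = m then
        \<i> * of_real (E powr (1/2)) / 2 * (cnj (zc x) - zc x / (lam l)\<^sup>2)
        - 3 * \<i> * of_real (E powr (3/2)) * of_real t * ((lam l)\<^sup>2 - 1 / (lam l) ^ 4)
        - gam l
      else 1 / (lam l - lam m))"

text \<open>Matrices are indexed from 0, the parameters from 1.\<close>

definition GZ_matrix ::
  "real \<Rightarrow> nat \<Rightarrow> (nat \<Rightarrow> complex) \<Rightarrow> (nat \<Rightarrow> complex) \<Rightarrow> real ^ 2 \<Rightarrow> real \<Rightarrow> complex mat" where
  "GZ_matrix E N lam gam x t =
     Matrix.mat (4*N) (4*N) (\<lambda>(l, m). GZ_entry E lam gam x t (Suc l) (Suc m))"

text \<open>The relations imposed on the parameters make \<open>det A\<close> a real-valued polynomial in \<open>(x, t)\<close>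
  times a nonzero complex constant. Its values lie on one real line through 0, so near a point where
  \<open>det A \<noteq> 0\<close> the principal branch \<open>Ln (det A)\<close> differs from any other continuous branch of
  \<open>ln det A\<close> by a constant, and the derivatives below do not depend on the branch.\<close>

definition GZ_v ::
  "real \<Rightarrow> nat \<Rightarrow> (nat \<Rightarrow> complex) \<Rightarrow> (nat \<Rightarrow> complex) \<Rightarrow> real ^ 2 \<Rightarrow> real \<Rightarrow> complex" where
  "GZ_v E N lam gam x t =
     - 4 * d_z (d_zbar (\<lambda>y. Ln (Determinant.det (GZ_matrix E N lam gam y t)))) x"

definition GZ_w ::
  "real \<Rightarrow> nat \<Rightarrow> (nat \<Rightarrow> complex) \<Rightarrow> (nat \<Rightarrow> complex) \<Rightarrow> real ^ 2 \<Rightarrow> real \<Rightarrow> complex" where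
  "GZ_w E N lam gam x t =
     12 * d_z (d_z (\<lambda>y. Ln (Determinant.det (GZ_matrix E N lam gam y t)))) x"

end

theory Submission
  imports Defs
begin

text \<open>
  Write \<open>\<tau>(x, t)\<close> for the determinant of the matrix of the pair. The relations between the parameters make all quotients of
  values of \<open>\<tau>\<close> real (\<open>GZ_tau_ratio_real\<close>), because complex conjugation transposes the matrix and rescales its rows and columns.
  Along every real line of space-time \<open>\<tau>\<close> is a polynomial of degree at most \<open>4 N\<close>, and its coefficient of degree \<open>4 N\<close> is the
  product of the linear parts of the diagonal entries in the direction of the line (\<open>GZ_tau_along_line\<close>).

  Suppose that the pair travels with velocity \<open>c\<close>. A real linear combination of \<open>v\<close> and \<open>w\<close> is the second derivative of
  \<open>ln \<tau>\<close> in the first coordinate. Two polynomials in one variable with the same degree and leading coefficient are equal if the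
  second derivatives of their logarithms agree; hence \<open>\<tau>(x, t) = \<tau>(x - t c, 0)\<close> identically
  (\<open>travelling_tau_translates\<close>). The leading parts of the two sides agree too, so their zero sets at time 1 agree. The linear part of the
  diagonal entry for the parameter \<open>l\<close> vanishes at time 1 exactly at \<open>GZ_velocity E l\<close>, whereas the leading part of the right-hand side
  vanishes only at \<open>c\<close>. So the velocities of all parameters are equal to \<open>c\<close> (\<open>travelling_velocity\<close>). For given \<open>c\<close> this is a
  cubic equation for \<open>l\<^sup>2\<close>, while \<open>N\<close> quadruples provide \<open>2 N\<close> distinct squares. Therefore \<open>N = 1\<close>. The same
  argument yields the formula for the velocity.

  Conversely, for \<open>N = 1\<close> the determinant can be evaluated: it is a constant times \<open>(\<bar>a\<bar>\<^sup>2 + h)\<^sup>2\<close>, where \<open>a\<close> is an affine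
  function of \<open>(x, t)\<close> and \<open>h > 0\<close> depends only on the parameters (\<open>GZ_tau_single_soliton\<close>). It has no zeros, and \<open>a\<close> depends on
  \<open>x - t c\<close> alone. The potentials are therefore explicit rational functions, smooth and of order \<open>\<bar>a\<bar>\<close> to the power \<open>- 2\<close> at infinity. That they
  solve the equation is a polynomial identity in \<open>a\<close> and its conjugate (\<open>soliton_polynomial_identity\<close>), which holds because of the
  value of \<open>h\<close>.
\<close>

section \<open>Closure properties of smooth functions\<close>

text \<open>The derivative of a product or reciprocal contains the undifferentiated factors, which the inductions below need
  at the lower order.\<close>

lemma C_k_Suc_imp: "C_k (Suc k) f \<Longrightarrow> C_k k f"
proof (induction k arbitrary: f)
  case 0
  then show ?case
    by (auto intro!: continuous_at_imp_continuous_on differentiable_imp_continuous_within)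
next
  case (Suc k)
  have "f differentiable at y" for y
    using Suc.prems by simp
  moreover have "C_k k (\<lambda>y. frechet_derivative f (at y) b)" if "b \<in> Basis" for b
    using Suc.prems that by (intro Suc.IH) (simp del: C_k.simps(1))
  ultimately show ?case
    by simp
qed

lemma C_k_const: "C_k k (\<lambda>_. c)"
proof (induction k arbitrary: c)
  case (Suc k)
  have "frechet_derivative (\<lambda>_. c) (at y) = (\<lambda>_. 0)" for y :: 'a
    by (rule frechet_derivative_const)
  with Suc show ?case
    by simp
qed simp

lemma C_k_bounded_linear:
  assumes "bounded_linear f"
  shows "C_k k f"
proof (cases k)
  case 0
  then show ?thesis
    by (simp add: assms linear_continuous_on)
next
  case (Suc n)
  have "(f has_derivative f) (at y)" for y
    using assms by (rule bounded_linear_imp_has_derivative)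
  then have "f differentiable at y" "frechet_derivative f (at y) = f" for y
    by (auto simp: differentiable_def dest: frechet_derivative_at[symmetric])
  with Suc show ?thesis
    by (simp add: C_k_const)
qed

lemma C_k_add:
  assumes "C_k k f" "C_k k g"
  shows "C_k k (\<lambda>x. f x + g x)"
  using assms
proof (induction k arbitrary: f g)
  case 0
  then show ?case
    by (auto intro: continuous_on_add)
next
  case (Suc k)
  have "((\<lambda>x. f x + g x) has_derivative
      (\<lambda>h. frechet_derivative f (at y) h + frechet_derivative g (at y) h)) (at y)" for y
    using Suc.prems by (auto intro!: has_derivative_add simp flip: frechet_derivative_works)
  then have "(\<lambda>x. f x + g x) differentiable at y"
    "frechet_derivative (\<lambda>x. f x + g x) (at y) =
      (\<lambda>h. frechet_derivative f (at y) h + frechet_derivative g (at y) h)" for y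
    by (auto simp: differentiable_def dest: frechet_derivative_at[symmetric])
  with Suc show ?case
    by simp
qed

lemma C_k_bounded_linear_compose:
  assumes "bounded_linear L" "C_k k f"
  shows "C_k k (\<lambda>x. L (f x))"
  using assms(2)
proof (induction k arbitrary: f)
  case 0
  then show ?case
    using bounded_linear.continuous_on[OF assms(1)] by simp
next
  case (Suc k)
  have "((\<lambda>x. L (f x)) has_derivative (\<lambda>h. L (frechet_derivative f (at y) h))) (at y)" for y
    using Suc.prems
    by (auto intro!: bounded_linear.has_derivative[OF assms(1)] simp flip: frechet_derivative_works)
  then have "(\<lambda>x. L (f x)) differentiable at y"
    "frechet_derivative (\<lambda>x. L (f x)) (at y) = (\<lambda>h. L (frechet_derivative f (at y) h))" for y
    by (auto simp: differentiable_def dest: frechet_derivative_at[symmetric])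
  with Suc show ?case
    by simp
qed

lemma C_k_mult:
  fixes f g :: "'a::euclidean_space \<Rightarrow> 'b::real_normed_algebra"
  assumes "C_k k f" "C_k k g"
  shows "C_k k (\<lambda>x. f x * g x)"
  using assms
proof (induction k arbitrary: f g)
  case 0
  then show ?case
    by (auto intro: continuous_on_mult)
next
  case (Suc k)
  have "((\<lambda>x. f x * g x) has_derivative
      (\<lambda>h. f y * frechet_derivative g (at y) h + frechet_derivative f (at y) h * g y)) (at y)" for y
    using Suc.prems by (auto intro!: has_derivative_mult simp flip: frechet_derivative_works)
  then have "(\<lambda>x. f x * g x) differentiable at y"
    "frechet_derivative (\<lambda>x. f x * g x) (at y) =
      (\<lambda>h. f y * frechet_derivative g (at y) h + frechet_derivative f (at y) h * g y)" for y
    by (auto simp: differentiable_def dest: frechet_derivative_at[symmetric])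
  with Suc show ?case
    using C_k_Suc_imp[OF Suc.prems(1)] C_k_Suc_imp[OF Suc.prems(2)] by (simp add: C_k_add)
qed

lemma C_k_inverse:
  fixes f :: "'a::euclidean_space \<Rightarrow> 'b::real_normed_field"
  assumes "C_k k f" "\<And>x. f x \<noteq> 0"
  shows "C_k k (\<lambda>x. inverse (f x))"
  using assms(1)
proof (induction k)
  case 0
  then show ?case
    using assms(2) by (auto intro: continuous_on_inverse)
next
  case (Suc k)
  have "((\<lambda>x. inverse (f x)) has_derivative
      (\<lambda>h. (-1) * (inverse (f y) * frechet_derivative f (at y) h * inverse (f y)))) (at y)" for y
    using Suc.prems Deriv.has_derivative_inverse[of f y, OF assms(2), of "frechet_derivative f (at y)" UNIV]
    by (auto simp flip: frechet_derivative_works)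
  then have "(\<lambda>x. inverse (f x)) differentiable at y"
    "frechet_derivative (\<lambda>x. inverse (f x)) (at y) =
      (\<lambda>h. (-1) * (inverse (f y) * frechet_derivative f (at y) h * inverse (f y)))" for y
    by (auto simp: differentiable_def dest: frechet_derivative_at[symmetric])
  moreover have "C_k k (\<lambda>y. (-1) * (inverse (f y) * frechet_derivative f (at y) b * inverse (f y)))"
    if "b \<in> Basis" for b
    using Suc.prems that
    by (intro C_k_mult C_k_const Suc.IH C_k_Suc_imp[OF Suc.prems]) (simp_all del: C_k.simps(1))
  ultimately show ?case
    by simp
qed

lemma smooth_const: "smooth (\<lambda>_. c)"
  by (simp add: smooth_def C_k_const)

lemma smooth_bounded_linear: "bounded_linear L \<Longrightarrow> smooth L"
  by (simp add: smooth_def C_k_bounded_linear)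

lemma smooth_bounded_linear_compose: "bounded_linear L \<Longrightarrow> smooth f \<Longrightarrow> smooth (\<lambda>x. L (f x))"
  by (simp add: smooth_def C_k_bounded_linear_compose)

lemma smooth_add: "smooth f \<Longrightarrow> smooth g \<Longrightarrow> smooth (\<lambda>x. f x + g x)"
  by (simp add: smooth_def C_k_add)

lemma smooth_mult: "smooth f \<Longrightarrow> smooth g \<Longrightarrow> smooth (\<lambda>x. f x * g x)"
  for f g :: "'a::euclidean_space \<Rightarrow> 'b::real_normed_algebra"
  by (auto simp: smooth_def C_k_mult)

lemma smooth_diff: "smooth f \<Longrightarrow> smooth g \<Longrightarrow> smooth (\<lambda>x. f x - g x)"
  using smooth_add[of f "\<lambda>x. - g x"] smooth_bounded_linear_compose[OF bounded_linear_minus[OF bounded_linear_ident], where f = g]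
  by simp

lemma smooth_divide: "smooth f \<Longrightarrow> smooth g \<Longrightarrow> (\<And>x. g x \<noteq> 0) \<Longrightarrow> smooth (\<lambda>x. f x / g x)"
  for f g :: "'a::euclidean_space \<Rightarrow> 'b::real_normed_field"
  unfolding divide_inverse by (auto simp: smooth_def C_k_mult C_k_inverse)

lemma smooth_power: "smooth f \<Longrightarrow> smooth (\<lambda>x. f x ^ n)"
  for f :: "'a::euclidean_space \<Rightarrow> 'b::real_normed_field"
  by (induction n) (simp_all add: smooth_const smooth_mult)

lemma smooth_sum: "(\<And>i. i \<in> A \<Longrightarrow> smooth (f i)) \<Longrightarrow> smooth (\<lambda>x. \<Sum>i\<in>A. f i x)"
  by (induction A rule: infinite_finite_induct) (auto simp: smooth_const smooth_add)

lemma smooth_prod: "(\<And>i. i \<in> A \<Longrightarrow> smooth (f i)) \<Longrightarrow> smooth (\<lambda>x. \<Prod>i\<in>A. f i x)"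
  for f :: "'i \<Rightarrow> 'a::euclidean_space \<Rightarrow> 'b::real_normed_field"
  by (induction A rule: infinite_finite_induct) (auto simp: smooth_const smooth_mult)

lemma smooth_imp_differentiable: "smooth f \<Longrightarrow> f differentiable at x"
  using C_k.simps(2)[of 0 f] by (simp add: smooth_def)

lemma smooth_frechet_derivative:
  assumes "smooth f" "b \<in> Basis"
  shows "smooth (\<lambda>x. frechet_derivative f (at x) b)"
  unfolding smooth_def
proof
  fix k
  have "C_k (Suc k) f"
    using assms(1) by (simp add: smooth_def del: C_k.simps)
  then show "C_k k (\<lambda>x. frechet_derivative f (at x) b)"
    using assms(2) by simp
qed

section \<open>Wirtinger derivatives\<close>

lemma bounded_linear_zc: "bounded_linear zc"
proof -
  have "zc = (\<lambda>x. of_real (x $ 1) + \<i> * of_real (x $ 2))"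
    by (auto simp: zc_def complex_eq_iff)
  moreover have "bounded_linear (\<lambda>x::real^2. of_real (x $ 1) + \<i> * of_real (x $ 2) :: complex)"
    by (intro bounded_linear_add bounded_linear_const_mult bounded_linear_compose[OF bounded_linear_of_real]
        bounded_linear_vec_nth)
  ultimately show ?thesis
    by metis
qed

lemma zc_axis: "zc (axis 1 1) = 1" "zc (axis 2 1) = \<i>"
  by (auto simp: zc_def axis_def complex_eq_iff)

lemma zc_add: "zc (x + y) = zc x + zc y" and zc_diff: "zc (x - y) = zc x - zc y"
  and zc_scaleR: "zc (r *\<^sub>R x) = of_real r * zc x" and zc_zero: "zc 0 = 0"
  by (auto simp: zc_def complex_eq_iff)

lemma norm_zc: "cmod (zc x) = norm x"
  by (simp add: zc_def cmod_def norm_vec_def L2_set_def sum_2 real_norm_def)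

lemma zc_surj: "\<exists>x. zc x = z"
  by (rule exI[of _ "vector [Re z, Im z]"]) (simp add: zc_def complex_eq_iff)

lemma vec2_decompose: "h = (h $ 1) *\<^sub>R axis 1 1 + (h $ 2) *\<^sub>R axis 2 (1::real)" for h :: "real^2"
  by (simp add: Finite_Cartesian_Product.vec_eq_iff forall_2 axis_def)

text \<open>The derivative of a function on the plane written in the basis of \<open>zc\<close> and its conjugate. The operators \<open>d_z\<close> and
  \<open>d_zbar\<close> are built from directional derivatives and return a value for every function; this relation also asserts
  differentiability, so that the product and quotient rules can be chained.\<close>

definition has_wirtinger ::
  "(real ^ 2 \<Rightarrow> complex) \<Rightarrow> complex \<Rightarrow> complex \<Rightarrow> real ^ 2 \<Rightarrow> bool" where
  "has_wirtinger f p q x \<longleftrightarrow> (f has_derivative (\<lambda>h. p * zc h + q * cnj (zc h))) (at x)"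

lemma has_derivative_partial:
  assumes "(f has_derivative f') (at x)"
  shows "((\<lambda>s. f (x + s *\<^sub>R u)) has_vector_derivative f' u) (at 0)"
proof -
  have "((\<lambda>s::real. x + s *\<^sub>R u) has_derivative (\<lambda>s. s *\<^sub>R u)) (at 0)"
    by (auto intro!: derivative_eq_intros)
  from has_derivative_compose[OF this, of f f'] assms
  have "((\<lambda>s. f (x + s *\<^sub>R u)) has_derivative (\<lambda>s. f' (s *\<^sub>R u))) (at 0)"
    by simp
  then show ?thesis
    using assms by (simp add: has_vector_derivative_def linear_scale has_derivative_linear)
qed

lemma has_wirtinger_direction:
  "has_wirtinger f p q x \<Longrightarrow>
    ((\<lambda>s. f (x + s *\<^sub>R u)) has_vector_derivative p * zc u + q * cnj (zc u)) (at 0)"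
  unfolding has_wirtinger_def by (rule has_derivative_partial)

lemma has_wirtinger_imp:
  assumes "has_wirtinger f p q x"
  shows "d_z f x = p" "d_zbar f x = q"
  using has_wirtinger_direction[OF assms, of "axis 1 1"] has_wirtinger_direction[OF assms, of "axis 2 1"]
  by (simp_all add: d_z_def d_zbar_def partial_x_def zc_axis vector_derivative_at algebra_simps)

lemma differentiable_partial:
  assumes "f differentiable at x"
  shows "partial_x k f x = frechet_derivative f (at x) (axis k 1)"
  using has_derivative_partial[of f _ x "axis k 1"] assms
  by (simp add: partial_x_def vector_derivative_at frechet_derivative_works)

lemma differentiable_imp_has_wirtinger:
  assumes "f differentiable at x"
  shows "has_wirtinger f (d_z f x) (d_zbar f x) x"
proof -
  let ?f' = "frechet_derivative f (at x)"
  have f': "(f has_derivative ?f') (at x)"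
    using assms by (simp add: frechet_derivative_works)
  have "?f' h = d_z f x * zc h + d_zbar f x * cnj (zc h)" for h
  proof -
    interpret linear ?f'
      using f' by (rule has_derivative_linear)
    have "?f' h = (h $ 1) *\<^sub>R ?f' (axis 1 1) + (h $ 2) *\<^sub>R ?f' (axis 2 1)"
      by (subst vec2_decompose[of h]) (simp add: add scaleR)
    also have "\<dots> = d_z f x * zc h + d_zbar f x * cnj (zc h)"
      using complex_eq[of "zc h"]
      by (simp add: d_z_def d_zbar_def differentiable_partial[OF assms] zc_def scaleR_conv_of_real
          complex_eq_iff field_simps)
    finally show ?thesis .
  qed
  then show ?thesis
    using f' unfolding has_wirtinger_def by (metis (no_types, lifting) ext)
qed

lemma has_wirtinger_const: "has_wirtinger (\<lambda>_. c) 0 0 x"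
  by (simp add: has_wirtinger_def)

lemma has_wirtinger_zc: "has_wirtinger zc 1 0 x"
  and has_wirtinger_cnj_zc: "has_wirtinger (\<lambda>x. cnj (zc x)) 0 1 x"
  unfolding has_wirtinger_def
  using bounded_linear_imp_has_derivative[OF bounded_linear_zc]
    bounded_linear_imp_has_derivative[OF bounded_linear_compose[OF bounded_linear_cnj bounded_linear_zc]]
  by simp_all

lemma has_wirtinger_add:
  "has_wirtinger f p q x \<Longrightarrow> has_wirtinger g p' q' x \<Longrightarrow>
    has_wirtinger (\<lambda>y. f y + g y) (p + p') (q + q') x"
  unfolding has_wirtinger_def by (rule has_derivative_eq_rhs, rule has_derivative_add) (assumption | auto simp: algebra_simps)+

lemma has_wirtinger_diff:
  "has_wirtinger f p q x \<Longrightarrow> has_wirtinger g p' q' x \<Longrightarrow>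
    has_wirtinger (\<lambda>y. f y - g y) (p - p') (q - q') x"
  unfolding has_wirtinger_def by (rule has_derivative_eq_rhs, rule has_derivative_diff) (assumption | auto simp: algebra_simps)+

lemma has_wirtinger_mult:
  "has_wirtinger f p q x \<Longrightarrow> has_wirtinger g p' q' x \<Longrightarrow>
    has_wirtinger (\<lambda>y. f y * g y) (f x * p' + p * g x) (f x * q' + q * g x) x"
  unfolding has_wirtinger_def by (rule has_derivative_eq_rhs, rule has_derivative_mult) (assumption | auto simp: algebra_simps)+

lemma has_wirtinger_cmult:
  "has_wirtinger f p q x \<Longrightarrow> has_wirtinger (\<lambda>y. c * f y) (c * p) (c * q) x"
  using has_wirtinger_mult[OF has_wirtinger_const] by simp

lemma has_wirtinger_compose_deriv:
  assumes "has_wirtinger f p q x" "(g has_field_derivative d) (at (f x))"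
  shows "has_wirtinger (\<lambda>y. g (f y)) (d * p) (d * q) x"
  using has_derivative_compose[OF assms(1)[unfolded has_wirtinger_def] assms(2)[unfolded has_field_derivative_def]]
  by (simp add: has_wirtinger_def algebra_simps)

lemma has_wirtinger_divide:
  assumes "has_wirtinger f p q x" "has_wirtinger g p' q' x" "g x \<noteq> 0"
  shows "has_wirtinger (\<lambda>y. f y / g y) ((p * g x - f x * p') / (g x)\<^sup>2) ((q * g x - f x * q') / (g x)\<^sup>2) x"
proof -
  have "(inverse has_field_derivative - (inverse (g x) ^ Suc (Suc 0))) (at (g x))"
    using assms(3) by (rule DERIV_inverse)
  from has_wirtinger_mult[OF assms(1) has_wirtinger_compose_deriv[OF assms(2) this]]
  show ?thesis
    using assms(3) by (simp add: divide_inverse[symmetric] field_simps power2_eq_square)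
qed

lemma has_wirtinger_transform:
  assumes "has_wirtinger f p q x" "\<forall>\<^sub>F y in nhds x. f y = g y"
  shows "has_wirtinger g p q x"
proof -
  have "\<forall>\<^sub>F y in at x. f y = g y" "f x = g x"
    using assms(2) eventually_nhds_x_imp_x by (auto simp: eventually_at_filter elim: eventually_mono)
  with assms(1) show ?thesis
    unfolding has_wirtinger_def using has_derivative_transform_eventually[of f _ x UNIV g] by simp
qed

lemma smooth_imp_has_wirtinger: "smooth f \<Longrightarrow> has_wirtinger f (d_z f x) (d_zbar f x) x"
  by (simp add: differentiable_imp_has_wirtinger smooth_imp_differentiable)

lemma smooth_wirtinger:
  assumes "smooth f"
  shows "smooth (d_z f)" "smooth (d_zbar f)"
proof -
  have *: "partial_x k f = (\<lambda>x. frechet_derivative f (at x) (axis k 1))" for k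
    using assms by (simp add: fun_eq_iff differentiable_partial smooth_imp_differentiable)
  have "smooth (partial_x k f)" for k
    unfolding * using assms by (rule smooth_frechet_derivative) (simp add: axis_in_Basis_iff)
  then have "smooth (\<lambda>x. (partial_x 1 f x - \<i> * partial_x 2 f x) / 2)"
    "smooth (\<lambda>x. (partial_x 1 f x + \<i> * partial_x 2 f x) / 2)"
    by (auto intro!: smooth_divide smooth_diff smooth_add smooth_mult smooth_const)
  then show "smooth (d_z f)" "smooth (d_zbar f)"
    by (simp_all add: d_z_def[abs_def] d_zbar_def[abs_def])
qed

text \<open>The principal logarithm may jump along the curve of values of \<open>f\<close>. Near \<open>x\<close> the quotient \<open>f y / f x\<close> is
  real by hypothesis and positive by continuity, so that \<open>Ln (f y) = Ln (f y / f x) + Ln (f x)\<close>, and the first summand is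
  differentiated at the harmless point 1.\<close>

lemma has_wirtinger_Ln:
  assumes f: "has_wirtinger f p q x" and nz: "f x \<noteq> 0" and real: "\<And>y. f y / f x \<in> \<real>"
  shows "has_wirtinger (\<lambda>y. Ln (f y)) (p / f x) (q / f x) x"
proof -
  define g where "g = (\<lambda>y. f y / f x)"
  have gx: "g x = 1"
    using nz by (simp add: g_def)
  have g: "has_wirtinger g (p / f x) (q / f x) x"
    unfolding g_def using has_wirtinger_cmult[OF f, of "1 / f x"] by simp
  have "(Ln has_field_derivative 1) (at (g x))"
    using has_field_derivative_Ln[of 1] by (simp add: gx)
  from has_wirtinger_add[OF has_wirtinger_compose_deriv[OF g this] has_wirtinger_const[of "Ln (f x)"]]
  have "has_wirtinger (\<lambda>y. Ln (g y) + Ln (f x)) (p / f x) (q / f x) x"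
    by simp
  moreover have "\<forall>\<^sub>F y in nhds x. Ln (g y) + Ln (f x) = Ln (f y)"
  proof -
    have "isCont (\<lambda>y. Re (g y)) x"
      using g unfolding has_wirtinger_def by (auto dest: has_derivative_continuous intro: continuous_intros)
    then have "\<forall>\<^sub>F y in nhds x. 0 < Re (g y)"
      using gx by (intro order_tendstoD(1)) (auto simp: isCont_def tendsto_nhds_iff)
    then show ?thesis
    proof eventually_elim
      case (elim y)
      have "g y = of_real (Re (g y))"
        using real[of y] by (simp add: g_def)
      moreover have "f y = g y * f x"
        using nz by (simp add: g_def)
      ultimately show ?case
        using Ln_times_of_real[OF elim nz] Ln_of_real[OF elim] by metis
    qed
  qed
  ultimately show ?thesis
    by (rule has_wirtinger_transform)
qed

lemma log_second_derivatives:
  assumes f: "smooth f" and real: "\<And>y y'. f y / f y' \<in> \<real>" and nz: "f x \<noteq> 0"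
  defines "L \<equiv> \<lambda>y. Ln (f y)"
  shows "d_z (d_zbar L) x = (d_z (d_zbar f) x * f x - d_zbar f x * d_z f x) / (f x)\<^sup>2"
    and "d_z (d_z L) x = (d_z (d_z f) x * f x - d_z f x * d_z f x) / (f x)\<^sup>2"
proof -
  have "continuous_on UNIV f"
    using f by (auto intro!: continuous_at_imp_continuous_on differentiable_imp_continuous_within smooth_imp_differentiable)
  then have "\<forall>\<^sub>F y in nhds x. f y \<noteq> 0"
    using nz continuous_on_open_vimage[of UNIV f] 
    by (auto simp: eventually_nhds intro!: exI[of _ "f -` (- {0})"] open_vimage)
  then have ev: "\<forall>\<^sub>F y in nhds x. d_z f y / f y = d_z L y" "\<forall>\<^sub>F y in nhds x. d_zbar f y / f y = d_zbar L y"
    using has_wirtinger_imp[OF has_wirtinger_Ln[OF smooth_imp_has_wirtinger[OF f] _ real]]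
    by (auto simp: L_def elim!: eventually_mono)
  show "d_z (d_zbar L) x = (d_z (d_zbar f) x * f x - d_zbar f x * d_z f x) / (f x)\<^sup>2"
    by (rule has_wirtinger_imp(1)[OF has_wirtinger_transform[OF has_wirtinger_divide ev(2)]])
      (use f nz in \<open>auto intro: smooth_imp_has_wirtinger smooth_wirtinger\<close>)
  show "d_z (d_z L) x = (d_z (d_z f) x * f x - d_z f x * d_z f x) / (f x)\<^sup>2"
    by (rule has_wirtinger_imp(1)[OF has_wirtinger_transform[OF has_wirtinger_divide ev(1)]])
      (use f nz in \<open>auto intro: smooth_imp_has_wirtinger smooth_wirtinger\<close>)
qed

section \<open>Determinants\<close>

lemma permutes_less: "p permutes {0..<n} \<Longrightarrow> i < n \<Longrightarrow> p i < n" for n i :: nat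
  using permutes_in_image[of p "{0..<n}" i] by simp

lemma smooth_det:
  fixes M :: "'a::euclidean_space \<Rightarrow> nat \<Rightarrow> nat \<Rightarrow> complex"
  assumes "\<And>i j. i < n \<Longrightarrow> j < n \<Longrightarrow> smooth (\<lambda>y. M y i j)"
  shows "smooth (\<lambda>y. Determinant.det (Matrix.mat n n (\<lambda>(i, j). M y i j)))"
proof -
  have "Determinant.det (Matrix.mat n n (\<lambda>(i, j). M y i j)) =
      (\<Sum>p\<in>{p. p permutes {0..<n}}. of_int (sign p) * (\<Prod>i = 0..<n. M y i (p i)))" for y
    by (subst det_def'[of _ n]) (auto intro!: sum.cong prod.cong simp: permutes_less)
  then show ?thesis
    using assms by (auto intro!: smooth_sum smooth_mult smooth_const smooth_prod simp: permutes_less)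
qed

text \<open>Rescaling row and column \<open>i\<close> by \<open>d i\<close> contributes \<open>(\<Prod>i. d i)\<^sup>2\<close>; transposing and renaming rows and columns by
  the same permutation leaves the determinant unchanged. Complex conjugation acts in this way on the matrix of a
  Grinevich--Zakharov pair.\<close>

lemma det_symmetric_rescaling:
  fixes B :: "nat \<Rightarrow> nat \<Rightarrow> 'a::comm_ring_1"
  assumes s: "s permutes {0..<n}"
  shows "Determinant.det (Matrix.mat n n (\<lambda>(i, j). d i * d j * B (s j) (s i))) =
    (\<Prod>i=0..<n. d i)\<^sup>2 * Determinant.det (Matrix.mat n n (\<lambda>(i, j). B i j))"
proof -
  let ?M = "\<lambda>F. Matrix.mat n n (\<lambda>(i, j). F i j)"
  have scale: "Determinant.det (?M (\<lambda>i j. d i * d j * B (s j) (s i))) =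
      (\<Prod>i=0..<n. d i)\<^sup>2 * Determinant.det (?M (\<lambda>i j. B (s j) (s i)))"
  proof -
    have "(\<Prod>i=0..<n. d i * d (p i) * B (s (p i)) (s i)) =
        (\<Prod>i=0..<n. d i)\<^sup>2 * (\<Prod>i=0..<n. B (s (p i)) (s i))" if "p permutes {0..<n}" for p
      using prod.permute[OF that, of d] by (simp add: prod.distrib power2_eq_square o_def)
    then show ?thesis
      by (subst (1 2) det_def'[of _ n])
        (auto intro!: sum.cong simp: permutes_less sum_distrib_left ac_simps)
  qed
  have rows: "Determinant.det (?M (\<lambda>i j. F (s i) j)) = signof s * Determinant.det (?M F)"
    for F :: "nat \<Rightarrow> nat \<Rightarrow> 'a"
  proof -
    have "?M (\<lambda>i j. F (s i) j) = Matrix.mat n n (\<lambda>(i, j). ?M F $$ (s i, j))"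
      using s by (intro eq_matI) (auto simp: permutes_less)
    then show ?thesis
      using det_permute_rows[OF _ s, of "?M F"] by simp
  qed
  have trans: "Determinant.det (?M (\<lambda>i j. F j i)) = Determinant.det (?M F)" for F :: "nat \<Rightarrow> nat \<Rightarrow> 'a"
  proof -
    have "?M (\<lambda>i j. F j i) = transpose_mat (?M F)"
      by (intro eq_matI) auto
    then show ?thesis
      by (simp add: det_transpose[of _ n])
  qed
  have "Determinant.det (?M (\<lambda>i j. B (s j) (s i))) = signof s * Determinant.det (?M (\<lambda>i j. B (s j) i))"
    using rows[of "\<lambda>i j. B (s j) i"] .
  also have "Determinant.det (?M (\<lambda>i j. B (s j) i)) = signof s * Determinant.det (?M B)"
    using trans[of "\<lambda>i j. B (s i) j"] rows[of B] by simp
  finally have "Determinant.det (?M (\<lambda>i j. B (s j) (s i))) = Determinant.det (?M B)"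
    by (simp add: sign_def)
  with scale show ?thesis
    by simp
qed

text \<open>Only the diagonal depends on the parameter \<open>s\<close>, so the term of the Leibniz expansion for a permutation \<open>p\<close>
  has degree at most the number of fixed points of \<open>p\<close>. The identity alone reaches degree \<open>n\<close>.\<close>

lemma det_diagonal_pencil:
  fixes d e :: "nat \<Rightarrow> complex"
  shows "\<exists>p. (\<forall>s. poly p s = Determinant.det (Matrix.mat n n (\<lambda>(i, j). if i = j then d i * s + e i else B i j)))
    \<and> coeff p n = (\<Prod>i=0..<n. d i) \<and> degree p \<le> n"
proof -
  define M where "M = (\<lambda>i j. if i = j then [:e i, d i:] else [:B i j:])"
  define T where "T = (\<lambda>p. \<Prod>i=0..<n. M i (p i))"
  define P where "P = (\<Sum>p\<in>{p. p permutes {0..<n}}. Polynomial.smult (of_int (sign p)) (T p))"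
  have degM: "degree (M i j) \<le> (if j = i then 1 else 0)" for i j
    by (simp add: M_def)
  have deg: "degree (T p) \<le> card {i\<in>{0..<n}. p i = i}" for p
  proof -
    have "degree (T p) \<le> (\<Sum>i=0..<n. degree (M i (p i)))"
      unfolding T_def using degree_prod_sum_le[of "{0..<n}" "\<lambda>i. M i (p i)"] by (simp add: o_def)
    also have "\<dots> \<le> (\<Sum>i=0..<n. if p i = i then 1 else 0)"
      by (intro sum_mono degM)
    also have "\<dots> = card {i\<in>{0..<n}. p i = i}"
      using sum.inter_filter[of "{0..<n}" "\<lambda>_. 1::nat" "\<lambda>i. p i = i"] by simp
    finally show ?thesis .
  qed
  have degP: "degree P \<le> n"
    unfolding P_def
  proof (intro degree_sum_le finite_permutations finite_atLeastLessThan order_trans[OF degree_smult_le])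
    fix p :: "nat \<Rightarrow> nat"
    have "card {i\<in>{0..<n}. p i = i} \<le> card {0..<n}"
      by (intro card_mono) auto
    then show "degree (T p) \<le> n"
      using deg[of p] by simp
  qed
  have coeff0: "coeff (T p) n = 0" if p: "p permutes {0..<n}" and "p \<noteq> id" for p
  proof (rule coeff_eq_0, rule le_less_trans[OF deg])
    obtain i where i: "p i \<noteq> i"
      using \<open>p \<noteq> id\<close> unfolding fun_eq_iff id_apply by blast
    have "i \<in> {0..<n}"
      using permutes_not_in[OF p, of i] i by blast
    then have "{i\<in>{0..<n}. p i = i} \<subset> {0..<n}"
      using i by blast
    then have "card {i\<in>{0..<n}. p i = i} < card {0..<n}"
      by (intro psubset_card_mono finite_atLeastLessThan)
    then show "card {i\<in>{0..<n}. p i = i} < n"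
      unfolding card_atLeastLessThan diff_zero .
  qed
  have coeffid: "coeff (\<Prod>i=0..<m. [:e i, d i:]) m = (\<Prod>i=0..<m. d i)" for m
  proof (induction m)
    case (Suc m)
    have "degree (\<Prod>i=0..<m. [:e i, d i:]) \<le> (\<Sum>i=0..<m. degree [:e i, d i:])"
      using degree_prod_sum_le[of "{0..<m}" "\<lambda>i. [:e i, d i:]"] by (simp only: o_def finite_atLeastLessThan simp_thms)
    also have "\<dots> \<le> (\<Sum>i=0..<m. 1)"
      by (intro sum_mono) simp
    finally have "degree (\<Prod>i=0..<m. [:e i, d i:]) \<le> m"
      by simp
    then show ?case
      using Suc by (simp add: coeff_eq_0)
  qed simp
  have "coeff P n = (\<Sum>p\<in>{p. p permutes {0..<n}}. if p = id then (\<Prod>i=0..<n. d i) else 0)"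
    unfolding P_def coeff_sum
  proof (intro sum.cong refl)
    fix p
    assume "p \<in> {p. p permutes {0..<n}}"
    then show "coeff (Polynomial.smult (of_int (sign p)) (T p)) n = (if p = id then \<Prod>i=0..<n. d i else 0)"
      using coeffid[of n] coeff0[of p] by (cases "p = id") (simp_all add: T_def M_def del: coeff_0)
  qed
  also have "\<dots> = (\<Prod>i=0..<n. d i)"
    using sum.delta[OF finite_permutations[OF finite_atLeastLessThan], of id "\<lambda>_. \<Prod>i=0..<n. d i" 0 n]
    by (simp only: mem_Collect_eq permutes_id if_True)
  finally have lead: "coeff P n = (\<Prod>i=0..<n. d i)" .
  have polyT: "poly (T p) s = (\<Prod>i=0..<n. if i = p i then d i * s + e i else B i (p i))" for p s
    unfolding T_def poly_prod by (intro prod.cong) (simp_all add: M_def)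
  have polyP: "poly P s = Determinant.det (Matrix.mat n n (\<lambda>(i, j). if i = j then d i * s + e i else B i j))" for s
  proof -
    have "poly P s = (\<Sum>p\<in>{p. p permutes {0..<n}}. of_int (sign p) * poly (T p) s)"
      by (simp add: P_def poly_sum)
    also have "\<dots> = Determinant.det (Matrix.mat n n (\<lambda>(i, j). if i = j then d i * s + e i else B i j))"
    proof (subst det_def'[of _ n], simp, intro sum.cong refl arg_cong2[of _ _ _ _ "(*)"])
      fix p
      assume "p \<in> {p. p permutes {0..<n}}"
      then have p: "p i < n" if "i < n" for i
        using that by (simp add: permutes_less)
      show "poly (T p) s =
          (\<Prod>i=0..<n. Matrix.mat n n (\<lambda>(i, j). if i = j then d i * s + e i else B i j) $$ (i, p i))"
        unfolding polyT by (intro prod.cong refl) (simp add: p)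
    qed
    finally show ?thesis .
  qed
  show ?thesis
    by (intro exI[of _ P] conjI allI polyP lead degP)
qed

lemma det_laplace_first_column:
  fixes F :: "nat \<Rightarrow> nat \<Rightarrow> 'a::comm_ring_1"
  shows "Determinant.det (Matrix.mat (Suc n) (Suc n) (\<lambda>(i, j). F i j)) =
    (\<Sum>i<Suc n. (- 1) ^ i * F i 0 *
      Determinant.det (Matrix.mat n n (\<lambda>(k, l). F (if k < i then k else Suc k) (Suc l))))"
proof -
  let ?A = "Matrix.mat (Suc n) (Suc n) (\<lambda>(i, j). F i j)"
  have "mat_delete ?A i 0 = Matrix.mat n n (\<lambda>(k, l). F (if k < i then k else Suc k) (Suc l))"
    if "i < Suc n" for i
    by (intro eq_matI) (auto simp: mat_delete_def)
  then have "?A $$ (i, 0) * cofactor ?A i 0 = (- 1) ^ i * F i 0 *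
      Determinant.det (Matrix.mat n n (\<lambda>(k, l). F (if k < i then k else Suc k) (Suc l)))"
    if "i < Suc n" for i
    using that by (simp add: cofactor_def)
  then show ?thesis
    by (subst laplace_expansion_column[of _ "Suc n" 0]) (simp_all del: sum.lessThan_Suc)
qed

text \<open>The two smaller sizes are stated with successors because that is the shape in which the expansion along the
  first column produces them.\<close>

lemma det_mat_2:
  "Determinant.det (Matrix.mat (Suc (Suc 0)) (Suc (Suc 0)) (\<lambda>(i, j). F i j)) =
    F 0 0 * F 1 1 - F 1 0 * (F 0 1 :: 'a::comm_ring_1)"
  by (simp add: det_laplace_first_column)

lemma det_mat_3:
  "Determinant.det (Matrix.mat (Suc (Suc (Suc 0))) (Suc (Suc (Suc 0))) (\<lambda>(i, j). F i j)) =
    F 0 0 * (F 1 1 * F 2 2 - F 2 1 * F 1 2) - F 1 0 * (F 0 1 * F 2 2 - F 2 1 * F 0 2)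
    + F 2 0 * (F 0 1 * F 1 2 - F 1 1 * (F 0 2 :: 'a::comm_ring_1))"
  using det_laplace_first_column[of "Suc (Suc 0)" F]
  by (simp add: det_mat_2 eval_nat_numeral)

lemma det_mat_4:
  "Determinant.det (Matrix.mat 4 4 (\<lambda>(i, j). F i j)) =
    F 0 0 * (F 1 1 * (F 2 2 * F 3 3 - F 3 2 * F 2 3) - F 2 1 * (F 1 2 * F 3 3 - F 3 2 * F 1 3)
      + F 3 1 * (F 1 2 * F 2 3 - F 2 2 * F 1 3))
    - F 1 0 * (F 0 1 * (F 2 2 * F 3 3 - F 3 2 * F 2 3) - F 2 1 * (F 0 2 * F 3 3 - F 3 2 * F 0 3)
      + F 3 1 * (F 0 2 * F 2 3 - F 2 2 * F 0 3))
    + F 2 0 * (F 0 1 * (F 1 2 * F 3 3 - F 3 2 * F 1 3) - F 1 1 * (F 0 2 * F 3 3 - F 3 2 * F 0 3)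
      + F 3 1 * (F 0 2 * F 1 3 - F 1 2 * F 0 3))
    - F 3 0 * (F 0 1 * (F 1 2 * F 2 3 - F 2 2 * F 1 3) - F 1 1 * (F 0 2 * F 2 3 - F 2 2 * F 0 3)
      + F 2 1 * (F 0 2 * F 1 3 - F 1 2 * (F 0 3 :: 'a::comm_ring_1)))"
  using det_laplace_first_column[of "Suc (Suc (Suc 0))" F]
  by (simp add: det_mat_3 eval_nat_numeral)

section \<open>The tau function\<close>

definition GZ_tau where
  "GZ_tau E N lam gam x t = Determinant.det (GZ_matrix E N lam gam x t)"

text \<open>The part of the diagonal entry for the parameter \<open>l\<close> that is linear in \<open>(x, t)\<close>. The products of these forms over
  all parameters are the leading coefficients of the tau function along lines.\<close>

definition GZ_form :: "real \<Rightarrow> complex \<Rightarrow> real ^ 2 \<Rightarrow> real \<Rightarrow> complex" where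
  "GZ_form E l x t = \<i> * of_real (E powr (1/2)) / 2 * (cnj (zc x) - zc x / l\<^sup>2)
     - 3 * \<i> * of_real (E powr (3/2)) * of_real t * (l\<^sup>2 - 1 / l ^ 4)"

definition GZ_velocity :: "real \<Rightarrow> complex \<Rightarrow> complex" where
  "GZ_velocity E l = 6 * of_real E * ((cnj l)\<^sup>2 + 1 / l\<^sup>2 + l\<^sup>2 / (cnj l)\<^sup>2)"

lemma GZ_entry_eq:
  "GZ_entry E lam gam x t l m = (if l = m then GZ_form E (lam l) x t - gam l else 1 / (lam l - lam m))"
  by (simp add: GZ_entry_def GZ_form_def)

lemma GZ_form_along_line:
  "GZ_form E l (x + s *\<^sub>R u) (t + s * r) = GZ_form E l u r * of_real s + GZ_form E l x t"
  by (simp add: GZ_form_def zc_add zc_scaleR add_divide_distrib ring_distribs) (simp add: algebra_simps)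

lemma powr_three_halves: "E > 0 \<Longrightarrow> E powr (3/2) = E * E powr (1/2)" for E :: real
  using powr_add[of E 1 "1/2"] by simp

text \<open>The number \<open>GZ_velocity E l\<close> solves \<open>cnj c - c / l\<^sup>2 = 6 E (l\<^sup>2 - 1 / l^4)\<close>. This is the equation for the
  time term of the diagonal entry to be absorbed by a translation of \<open>x\<close> with velocity \<open>c\<close>.\<close>

lemma GZ_form_comoving:
  assumes "E > 0" "l \<noteq> 0"
  shows "GZ_form E l x t = \<i> * of_real (E powr (1/2)) / 2 *
    (cnj (zc x - of_real t * GZ_velocity E l) - (zc x - of_real t * GZ_velocity E l) / l\<^sup>2)"
proof -
  have "cnj (GZ_velocity E l) - GZ_velocity E l / l\<^sup>2 = 6 * of_real E * (l\<^sup>2 - 1 / l ^ 4)"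
    using assms by (simp add: GZ_velocity_def field_simps power2_eq_square power4_eq_xxxx)
  then have "of_real t * (cnj (GZ_velocity E l) - GZ_velocity E l / l\<^sup>2) = of_real t * (6 * of_real E * (l\<^sup>2 - 1 / l ^ 4))"
    by simp
  then have "cnj (zc x - of_real t * GZ_velocity E l) - (zc x - of_real t * GZ_velocity E l) / l\<^sup>2 =
      cnj (zc x) - zc x / l\<^sup>2 - 6 * of_real E * of_real t * (l\<^sup>2 - 1 / l ^ 4)"
    by (simp add: diff_divide_distrib algebra_simps)
  moreover have "\<i> * S / 2 * W - 3 * \<i> * (e * S) * T * M = \<i> * S / 2 * (W - 6 * e * T * M)" for S W e T M :: complex
    by (simp add: field_simps)
  ultimately show ?thesis
    unfolding GZ_form_def powr_three_halves[OF assms(1)] by (simp only: of_real_mult)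
qed

lemma cmod_power2_neq_1: "cmod k \<noteq> 1 \<Longrightarrow> (cmod k)\<^sup>2 \<noteq> 1"
  using norm_ge_zero[of k] by (auto simp: power2_eq_1_iff simp del: norm_ge_zero)

text \<open>Off the unit circle \<open>d \<mapsto> cnj d - d / l\<^sup>2\<close> is injective, because its two terms have different absolute values
  unless \<open>d = 0\<close>. Each form therefore vanishes at exactly one point of the plane at each time.\<close>

lemma GZ_form_eq_0_iff:
  assumes "E > 0" "l \<noteq> 0" "cmod l \<noteq> 1"
  shows "GZ_form E l x t = 0 \<longleftrightarrow> zc x = of_real t * GZ_velocity E l"
proof -
  define d where "d = zc x - of_real t * GZ_velocity E l"
  have "d = 0" if "cnj d = d / l\<^sup>2"
  proof -
    have "cmod d = cmod d / (cmod l)\<^sup>2"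
      using arg_cong[OF that, of cmod] by (simp add: norm_divide norm_power)
    moreover have "(cmod l)\<^sup>2 \<noteq> 1"
      using assms(3) by (rule cmod_power2_neq_1)
    ultimately show ?thesis
      using assms(2) by (simp add: field_simps)
  qed
  then have "cnj d - d / l\<^sup>2 = 0 \<longleftrightarrow> d = 0"
    by auto
  moreover have "GZ_form E l x t = 0 \<longleftrightarrow> cnj d - d / l\<^sup>2 = 0"
    unfolding GZ_form_comoving[OF assms(1,2)] d_def using assms(1) by simp
  ultimately show ?thesis
    by (simp add: d_def)
qed

lemma smooth_GZ_tau: "smooth (\<lambda>x. GZ_tau E N lam gam x t)"
proof -
  have "smooth (\<lambda>x. GZ_form E l x t)" for l
    unfolding GZ_form_def divide_inverse
    by (intro smooth_diff smooth_mult smooth_const smooth_bounded_linear bounded_linear_zc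
        bounded_linear_compose[OF bounded_linear_cnj bounded_linear_zc])
  then have "smooth (\<lambda>x. GZ_entry E lam gam x t l m)" for l m
    by (cases "l = m") (auto simp: GZ_entry_eq intro: smooth_diff smooth_const)
  then show ?thesis
    unfolding GZ_tau_def GZ_matrix_def by (intro smooth_det)
qed

lemma GZ_tau_along_line:
  "\<exists>p. (\<forall>s. GZ_tau E N lam gam (x + s *\<^sub>R u) (t + s * r) = poly p (of_real s))
    \<and> coeff p (4 * N) = (\<Prod>l=0..<4*N. GZ_form E (lam (Suc l)) u r) \<and> degree p \<le> 4 * N"
proof -
  obtain p where p: "\<forall>s. poly p s = Determinant.det (Matrix.mat (4*N) (4*N) (\<lambda>(i, j). if i = j
        then GZ_form E (lam (Suc i)) u r * s + (GZ_form E (lam (Suc i)) x t - gam (Suc i))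
        else 1 / (lam (Suc i) - lam (Suc j))))"
    and c: "coeff p (4*N) = (\<Prod>l=0..<4*N. GZ_form E (lam (Suc l)) u r)" "degree p \<le> 4*N"
    using det_diagonal_pencil[of "4*N" "\<lambda>i. GZ_form E (lam (Suc i)) u r"
        "\<lambda>i. GZ_form E (lam (Suc i)) x t - gam (Suc i)" "\<lambda>i j. 1 / (lam (Suc i) - lam (Suc j))"] by blast
  have "GZ_tau E N lam gam (x + s *\<^sub>R u) (t + s * r) = poly p (of_real s)" for s
    unfolding p[rule_format] GZ_tau_def GZ_matrix_def
    by (intro arg_cong[of _ _ Determinant.det] eq_matI) (auto simp: GZ_entry_eq GZ_form_along_line)
  with c show ?thesis
    by blast
qed

text \<open>The involution of indices \<open>4 q \<leftrightarrow> 4 q + 2\<close>, \<open>4 q + 1 \<leftrightarrow> 4 q + 3\<close>. The parameter of index \<open>Suc i\<close> is paired with its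
  reflection in the unit circle; matrix indices start at 0, hence the successors below.\<close>

definition GZ_partner :: "nat \<Rightarrow> nat \<Rightarrow> nat" where
  "GZ_partner N i = (if i < 4 * N then if i mod 4 < 2 then i + 2 else i - 2 else i)"

lemma GZ_partner_involution:
  "GZ_partner N i < 4 * N" "GZ_partner N (GZ_partner N i) = i" if "i < 4 * N"
proof -
  obtain q r where i: "i = 4 * q + r" "r < 4"
    by (metis mod_less_divisor mult_div_mod_eq zero_less_numeral)
  with that have q: "q < N"
    by simp
  have "r = 0 \<or> r = 1 \<or> r = 2 \<or> r = 3"
    using i(2) by auto
  with i q show "GZ_partner N i < 4 * N" "GZ_partner N (GZ_partner N i) = i"
    by (auto simp: GZ_partner_def mod_Suc)
qed

lemma GZ_partner_permutes: "GZ_partner N permutes {0..<4 * N}"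
proof (rule bij_imp_permutes)
  show "bij_betw (GZ_partner N) {0..<4 * N} {0..<4 * N}"
    by (rule bij_betw_byWitness[where f' = "GZ_partner N"]) (auto simp: GZ_partner_involution)
qed (auto simp: GZ_partner_def)

text \<open>Each quadruple of parameters is determined by its first member, \<open>lam (4 q + 1)\<close> and \<open>gam (4 q + 1)\<close>.\<close>

lemma GZ_params_quadruple:
  assumes "GZ_params N lam gam" "q < N"
  shows "lam (4*q + 2) = - lam (4*q + 1)" "lam (4*q + 3) = 1 / cnj (lam (4*q + 1))"
    "lam (4*q + 4) = - (1 / cnj (lam (4*q + 1)))"
    "gam (4*q + 2) = gam (4*q + 1) - 1 / lam (4*q + 1)"
    "gam (4*q + 3) = (cnj (lam (4*q + 1)))\<^sup>2 * cnj (gam (4*q + 1))"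
    "gam (4*q + 4) = (cnj (lam (4*q + 1)))\<^sup>2 * cnj (gam (4*q + 1)) - cnj (lam (4*q + 1))"
    "lam (4*q + 1) \<noteq> 0"
proof -
  have idx: "2 * (2*q + 1) = 4*q + 2" "2 * (2*q + 1) - 1 = 4*q + 1"
    "2 * (2*q + 2) = 4*q + 4" "2 * (2*q + 2) - 1 = 4*q + 3"
    "4*q + 2 - 1 = 4*q + 1" "4*q + 4 - 1 = 4*q + 3" "4 * (q + 1) - 1 = 4*q + 3" "4 * (q + 1) - 3 = 4*q + 1"
    by presburger+
  have pair: "lam (2*j) = - lam (2*j - 1) \<and> gam (2*j - 1) - gam (2*j) = 1 / lam (2*j - 1)" if "j \<in> {1..2*N}" for j
    using assms(1) that by (auto simp: GZ_params_def)
  have refl: "lam (4*j - 1) = 1 / cnj (lam (4*j - 3)) \<and> gam (4*j - 1) = (cnj (lam (4*j - 3)))\<^sup>2 * cnj (gam (4*j - 3))"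
    if "j \<in> {1..N}" for j
    using assms(1) that by (auto simp: GZ_params_def)
  have a: "lam (4*q + 2) = - lam (4*q + 1) \<and> gam (4*q + 1) - gam (4*q + 2) = 1 / lam (4*q + 1)"
  proof -
    have "2*q + 1 \<in> {1..2*N}"
      using assms(2) by simp
    from pair[OF this] show ?thesis
      unfolding idx .
  qed
  have b: "lam (4*q + 4) = - lam (4*q + 3) \<and> gam (4*q + 3) - gam (4*q + 4) = 1 / lam (4*q + 3)"
  proof -
    have "2*q + 2 \<in> {1..2*N}"
      using assms(2) by simp
    from pair[OF this] show ?thesis
      unfolding idx .
  qed
  have c: "lam (4*q + 3) = 1 / cnj (lam (4*q + 1)) \<and> gam (4*q + 3) = (cnj (lam (4*q + 1)))\<^sup>2 * cnj (gam (4*q + 1))"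
  proof -
    have "q + 1 \<in> {1..N}"
      using assms(2) by simp
    from refl[OF this] show ?thesis
      unfolding idx .
  qed
  show "lam (4*q + 2) = - lam (4*q + 1)" "lam (4*q + 3) = 1 / cnj (lam (4*q + 1))"
    "lam (4*q + 4) = - (1 / cnj (lam (4*q + 1)))"
    "gam (4*q + 3) = (cnj (lam (4*q + 1)))\<^sup>2 * cnj (gam (4*q + 1))"
    using a b c by (simp_all only: simp_thms)
  show "gam (4*q + 2) = gam (4*q + 1) - 1 / lam (4*q + 1)"
    using conjunct2[OF a] by (metis diff_diff_eq2 add_diff_cancel_left')
  have "gam (4*q + 4) = gam (4*q + 3) - 1 / lam (4*q + 3)"
    using conjunct2[OF b] by (metis diff_diff_eq2 add_diff_cancel_left')
  then show "gam (4*q + 4) = (cnj (lam (4*q + 1)))\<^sup>2 * cnj (gam (4*q + 1)) - cnj (lam (4*q + 1))"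
    using c by simp
  show "lam (4*q + 1) \<noteq> 0"
    using assms by (auto simp: GZ_params_def)
qed

lemma GZ_partner_params:
  assumes params: "GZ_params N lam gam" and i: "i < 4 * N"
  defines "l \<equiv> cnj (lam (Suc i))"
  shows "lam (Suc (GZ_partner N i)) = 1 / l" "gam (Suc (GZ_partner N i)) = l\<^sup>2 * cnj (gam (Suc i))" "l \<noteq> 0"
proof -
  obtain q r where q: "i = 4 * q + r" "r < 4"
    by (metis mod_less_divisor mult_div_mod_eq zero_less_numeral)
  with i have "q < N"
    by simp
  define a where "a = lam (4*q + 1)"
  define g where "g = gam (4*q + 1)"
  have Suc: "Suc (4*q) = 4*q + 1" "Suc (4*q + 1) = 4*q + 2" "Suc (4*q + 2) = 4*q + 3" "Suc (4*q + 3) = 4*q + 4"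
    by simp_all
  note quad = GZ_params_quadruple[OF params \<open>q < N\<close>, folded a_def g_def]
  have "r = 0 \<or> r = 1 \<or> r = 2 \<or> r = 3"
    using q(2) by auto
  then consider "i = 4*q" "GZ_partner N i = 4*q + 2" | "i = 4*q + 1" "GZ_partner N i = 4*q + 3"
    | "i = 4*q + 2" "GZ_partner N i = 4*q" | "i = 4*q + 3" "GZ_partner N i = 4*q + 1"
    using q(1) i by (auto simp: GZ_partner_def mod_Suc)
  then have "lam (Suc (GZ_partner N i)) = 1 / l \<and> gam (Suc (GZ_partner N i)) = l\<^sup>2 * cnj (gam (Suc i)) \<and> l \<noteq> 0"
    unfolding l_def using quad(7)
    by cases (simp_all only: Suc quad(1-6) a_def[symmetric] g_def[symmetric], simp_all add: field_simps power2_eq_square)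
  then show "lam (Suc (GZ_partner N i)) = 1 / l" "gam (Suc (GZ_partner N i)) = l\<^sup>2 * cnj (gam (Suc i))" "l \<noteq> 0"
    by blast+
qed

lemma cnj_GZ_form:
  assumes "l \<noteq> 0"
  shows "cnj (GZ_form E l x t) = (1 / (cnj l)\<^sup>2) * GZ_form E (1 / cnj l) x t"
  using assms by (simp add: GZ_form_def field_simps power2_eq_square power4_eq_xxxx)

text \<open>With \<open>\<mu> = 1 / cnj l\<close> one has \<open>1 / cnj (l - l') = \<mu> \<mu>' / (\<mu>' - \<mu>)\<close> off the diagonal, while the diagonal entries pick up the
  factor \<open>\<mu>\<^sup>2\<close>. So conjugation is reflection of the parameters, followed by transposition and a rescaling of rows and columns.\<close>

lemma cnj_GZ_tau:
  assumes "GZ_params N lam gam"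
  shows "cnj (GZ_tau E N lam gam x t) = (\<Prod>i=0..<4*N. 1 / cnj (lam (Suc i)))\<^sup>2 * GZ_tau E N lam gam x t"
proof -
  interpret cnj: comm_ring_hom cnj
    by unfold_locales simp_all
  let ?s = "GZ_partner N" and ?B = "\<lambda>i j. GZ_entry E lam gam x t (Suc i) (Suc j)"
  let ?d = "\<lambda>i. 1 / cnj (lam (Suc i))"
  have entry: "cnj (?B i j) = ?d i * ?d j * ?B (?s j) (?s i)" if ij: "i < 4*N" "j < 4*N" for i j
  proof (cases "i = j")
    case True
    have eq: "1 / L * (1 / L) * (F - L\<^sup>2 * g) = 1 / L\<^sup>2 * F - g" if "L \<noteq> 0" for L F g :: complex
      using that by (simp add: field_simps power2_eq_square)
    have "lam (Suc i) \<noteq> 0"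
      using GZ_partner_params(3)[OF assms ij(1)] by auto
    then show ?thesis
      unfolding GZ_entry_eq True[symmetric]
      by (simp only: if_True complex_cnj_diff refl cnj_GZ_form[OF \<open>lam (Suc i) \<noteq> 0\<close>] GZ_partner_params(1,2)[OF assms ij(1)]
          eq[OF GZ_partner_params(3)[OF assms ij(1)]])
  next
    case False
    then have ne: "?s i \<noteq> ?s j"
      using GZ_partner_involution(2)[of i N] GZ_partner_involution(2)[of j N] ij by metis
    note pi = GZ_partner_params[OF assms ij(1)] and pj = GZ_partner_params[OF assms ij(2)]
    have "1 / (cnj (lam (Suc i)) - cnj (lam (Suc j))) =
        ?d i * ?d j * (1 / (1 / cnj (lam (Suc j)) - 1 / cnj (lam (Suc i))))"
      using pi(3) pj(3) by (cases "cnj (lam (Suc i)) = cnj (lam (Suc j))") (simp_all add: field_simps)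
    then show ?thesis
      unfolding GZ_entry_eq using False ne pi(1) pj(1) by simp
  qed
  have "cnj (GZ_tau E N lam gam x t) = Determinant.det (map_mat cnj (GZ_matrix E N lam gam x t))"
    by (simp add: GZ_tau_def)
  also have "map_mat cnj (GZ_matrix E N lam gam x t) =
      Matrix.mat (4*N) (4*N) (\<lambda>(i, j). ?d i * ?d j * ?B (?s j) (?s i))"
    using entry by (intro eq_matI) (simp_all add: GZ_matrix_def)
  also have "Determinant.det \<dots> = (\<Prod>i=0..<4*N. ?d i)\<^sup>2 * GZ_tau E N lam gam x t"
    unfolding GZ_tau_def GZ_matrix_def by (rule det_symmetric_rescaling[OF GZ_partner_permutes])
  finally show ?thesis .
qed

text \<open>The factor by which conjugation multiplies the tau function does not depend on the point, hence it cancels in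
  a quotient of two values.\<close>

lemma GZ_tau_ratio_real:
  assumes "GZ_params N lam gam"
  shows "GZ_tau E N lam gam x t / GZ_tau E N lam gam y s \<in> \<real>"
proof -
  have "(\<Prod>i=0..<4*N. 1 / cnj (lam (Suc i)))\<^sup>2 \<noteq> 0"
    using GZ_partner_params(3)[OF assms] by simp
  then show ?thesis
    by (simp add: Reals_cnj_iff cnj_GZ_tau[OF assms])
qed

section \<open>Travelling forces a translating tau function\<close>

text \<open>The coefficients of \<open>a' b\<close> and \<open>a b'\<close> in degree \<open>deg a + deg b - 1\<close> are \<open>deg a\<close> and \<open>deg b\<close> times the same number.\<close>

lemma degree_eq_if_wronskian_eq_0:
  fixes a b :: "'a::field_char_0 poly"
  assumes "a \<noteq> 0" "b \<noteq> 0" and W: "pderiv a * b = a * pderiv b"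
  shows "degree a = degree b"
proof (cases "degree a = 0 \<or> degree b = 0")
  case True
  then have "pderiv a = 0 \<or> pderiv b = 0"
    by (simp add: pderiv_eq_0_iff)
  then have "pderiv a = 0 \<and> pderiv b = 0"
    using W assms(1,2) by auto
  then show ?thesis
    by (simp add: pderiv_eq_0_iff)
next
  case False
  have lead: "lead_coeff (pderiv c) = of_nat (degree c) * lead_coeff c" if "degree c \<noteq> 0" for c :: "'a poly"
    using that by (simp add: degree_pderiv coeff_pderiv del: of_nat_diff)
  have "degree (pderiv a) + degree b = degree a + degree (pderiv b)"
    using False by (simp add: degree_pderiv)
  then have "lead_coeff (pderiv a) * lead_coeff b = lead_coeff a * lead_coeff (pderiv b)"
    using coeff_mult_degree_sum[of "pderiv a" b] coeff_mult_degree_sum[of a "pderiv b"] W by metis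
  then have "(of_nat (degree a) - of_nat (degree b)) * (lead_coeff a * lead_coeff b) = 0"
    using False by (simp add: lead left_diff_distrib mult_ac)
  then have "of_nat (degree a) = (of_nat (degree b) :: 'a)"
    using assms(1,2) by simp
  then show ?thesis
    by simp
qed

text \<open>The hypothesis says \<open>(ln p)'' = (ln q)''\<close>. Integrating by hand, the Wronskian \<open>m = p' q - p q'\<close> satisfies
  \<open>m' (p q) = m (p q)'\<close>, so it would have the degree of \<open>p q\<close> if it were nonzero, which is too large. For \<open>m = 0\<close> the same
  argument applies to \<open>p - q\<close>, whose degree is below that of \<open>q\<close> because the leading coefficients cancel.\<close>

lemma poly_eq_if_log_second_derivative_eq:
  fixes p q :: "'a::field_char_0 poly"
  assumes "degree p = n" "degree q = n" "lead_coeff p = lead_coeff q" "p \<noteq> 0"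
    and eq: "(pderiv (pderiv p) * p - (pderiv p)\<^sup>2) * q\<^sup>2 = (pderiv (pderiv q) * q - (pderiv q)\<^sup>2) * p\<^sup>2"
  shows "p = q"
proof -
  have "q \<noteq> 0"
    using assms(3,4) by auto
  \<comment> \<open>the first integration: \<open>(ln p)' = (ln q)'\<close>\<close>
  have W: "pderiv p * q = p * pderiv q"
  proof (rule ccontr)
    define m where "m = pderiv p * q - p * pderiv q"
    assume "\<not> ?thesis"
    then have "m \<noteq> 0"
      by (simp add: m_def)
    have "pderiv m * (p * q) - m * pderiv (p * q) =
        (pderiv (pderiv p) * p - (pderiv p)\<^sup>2) * q\<^sup>2 - (pderiv (pderiv q) * q - (pderiv q)\<^sup>2) * p\<^sup>2"
      by (simp add: m_def pderiv_diff pderiv_mult power2_eq_square) (simp add: algebra_simps)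
    with eq have "pderiv m * (p * q) = m * pderiv (p * q)"
      by simp
    then have "degree m = degree (p * q)"
      using \<open>m \<noteq> 0\<close> \<open>p \<noteq> 0\<close> \<open>q \<noteq> 0\<close> by (intro degree_eq_if_wronskian_eq_0) simp_all
    then have deg: "degree m = n + n"
      using \<open>p \<noteq> 0\<close> \<open>q \<noteq> 0\<close> assms(1,2) by (simp add: degree_mult_eq)
    show False
    proof (cases "n = 0")
      case True
      then have "pderiv p = 0" "pderiv q = 0"
        using assms(1,2) by (simp_all add: pderiv_eq_0_iff)
      then show False
        using \<open>m \<noteq> 0\<close> by (simp add: m_def)
    next
      case False
      have "degree (pderiv p * q) \<le> (n - 1) + n" "degree (p * pderiv q) \<le> n + (n - 1)"
        using degree_mult_le[of "pderiv p" q] degree_mult_le[of p "pderiv q"] assms(1,2)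
        by (simp_all add: degree_pderiv)
      then have "degree m \<le> n + (n - 1)"
        unfolding m_def by (intro degree_diff_le) simp_all
      with deg False show False
        by simp
    qed
  qed
  show "p = q"
  proof (rule ccontr)
    define r where "r = p - q"
    assume "p \<noteq> q"
    then have "r \<noteq> 0"
      by (simp add: r_def)
    have "pderiv r * q = r * pderiv q"
      using W by (simp add: r_def pderiv_diff left_diff_distrib)
    then have "degree r = n"
      using degree_eq_if_wronskian_eq_0[OF \<open>r \<noteq> 0\<close> \<open>q \<noteq> 0\<close>] assms(2) by simp
    moreover have "coeff r n = 0"
      using assms(1-3) by (simp add: r_def)
    ultimately show False
      using \<open>r \<noteq> 0\<close> by auto
  qed
qed

lemma has_vector_derivative_Reals:
  fixes g :: "real \<Rightarrow> complex"
  assumes "(g has_vector_derivative d) (at s)" "\<And>r. g r \<in> \<real>"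
  shows "d \<in> \<real>"
proof -
  have "((\<lambda>r. Im (g r)) has_vector_derivative Im d) (at s)"
    using assms(1) by (rule bounded_linear.has_vector_derivative[OF bounded_linear_Im])
  moreover have "(\<lambda>r. Im (g r)) = (\<lambda>r. 0)"
    using assms(2) by (auto simp: complex_is_Real_iff)
  ultimately have "((\<lambda>r. 0) has_vector_derivative Im d) (at s)"
    by simp
  then have "Im d = 0"
    using vector_derivative_unique_at has_vector_derivative_const by blast
  then show ?thesis
    by (simp add: complex_is_Real_iff)
qed

text \<open>Since \<open>d_z + d_zbar = \<partial>\<^sub>1\<close>, the sum on the left is \<open>d_z (\<partial>\<^sub>1 L)\<close>. The function \<open>\<partial>\<^sub>1 L\<close> is real because values of \<open>f\<close> have real
  quotients, so the real part of \<open>d_z (\<partial>\<^sub>1 L)\<close> is half of \<open>\<partial>\<^sub>1 \<partial>\<^sub>1 L\<close>, and this can be computed on a horizontal line.\<close>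

lemma log_second_derivative_on_line:
  assumes f: "smooth f" and real: "\<And>y y'. f y / f y' \<in> \<real>" and nz: "f y \<noteq> 0"
    and line: "\<And>r. f (y + r *\<^sub>R axis 1 1) = poly p (of_real (s + r))"
  defines "L \<equiv> \<lambda>y. Ln (f y)"
  shows "of_real (2 * Re (d_z (d_z L) y + d_z (d_zbar L) y)) =
    (poly (pderiv (pderiv p)) (of_real s) * poly p (of_real s) - (poly (pderiv p) (of_real s))\<^sup>2) / (poly p (of_real s))\<^sup>2"
proof -
  define g where "g = (\<lambda>y. d_z f y + d_zbar f y)"
  define G where "G = (\<lambda>y. g y / f y)"
  have w: "has_wirtinger f (d_z f z) (d_zbar f z) z" for z
    using f by (rule smooth_imp_has_wirtinger)
  have g: "smooth g"
    unfolding g_def using f by (intro smooth_add smooth_wirtinger)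
  have G_real: "G z \<in> \<real>" for z
  proof -
    have "((\<lambda>r. f (z + r *\<^sub>R axis 1 1) * (1 / f z)) has_vector_derivative g z * (1 / f z)) (at 0)"
      using has_wirtinger_direction[OF w, of z "axis 1 1"] unfolding g_def
      by (intro has_vector_derivative_mult_left) (simp add: zc_axis)
    from has_vector_derivative_Reals[OF this] real show ?thesis
      by (simp add: G_def)
  qed
  have gline: "g (y + r *\<^sub>R axis 1 1) = poly (pderiv p) (of_real (s + r))" for r
  proof -
    let ?z = "y + r *\<^sub>R axis 1 1"
    have "((\<lambda>h. f (?z + h *\<^sub>R axis 1 1)) has_vector_derivative g ?z) (at 0)"
      using has_wirtinger_direction[OF w, of ?z "axis 1 1"] by (simp add: g_def zc_axis)
    moreover have "f (?z + h *\<^sub>R axis 1 1) = poly p (of_real (s + r) + of_real h)" for h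
      using line[of "r + h"] by (simp add: scaleR_add_left add.assoc)
    moreover have "((\<lambda>h. poly p (of_real (s + r) + of_real h)) has_vector_derivative
        poly (pderiv p) (of_real (s + r))) (at 0)"
    proof -
      have "((\<lambda>h. poly p (of_real (s + r) + h)) has_field_derivative poly (pderiv p) (of_real (s + r)))
          (at (of_real 0))"
        by (auto intro!: derivative_eq_intros)
      then show ?thesis
        by (rule has_vector_derivative_real_field)
    qed
    ultimately show ?thesis
      using vector_derivative_unique_at by auto
  qed
  define P Q where "P = d_z G y" and "Q = d_zbar G y"
  have wG: "has_wirtinger G ((d_z g y * f y - g y * d_z f y) / (f y)\<^sup>2) ((d_zbar g y * f y - g y * d_zbar f y) / (f y)\<^sup>2) y"
    unfolding G_def by (intro has_wirtinger_divide smooth_imp_has_wirtinger f g nz)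
  then have PQ: "has_wirtinger G P Q y" and P: "P = (d_z g y * f y - g y * d_z f y) / (f y)\<^sup>2"
    using has_wirtinger_imp[OF wG] by (simp_all add: P_def Q_def)
  have dzg: "d_z g y = d_z (d_z f) y + d_z (d_zbar f) y"
    unfolding g_def
    by (rule has_wirtinger_imp(1)[OF has_wirtinger_add[OF smooth_imp_has_wirtinger smooth_imp_has_wirtinger]])
      (intro smooth_wirtinger f)+
  have "d_z (d_z L) y + d_z (d_zbar L) y = P"
    unfolding P dzg L_def log_second_derivatives[of f, OF f real nz]
    by (simp add: g_def add_divide_distrib diff_divide_distrib algebra_simps)
  moreover
  \<comment> \<open>the derivatives of the real function \<open>G\<close> in the two coordinate directions\<close>
  have "P + Q \<in> \<real>" "\<i> * P - \<i> * Q \<in> \<real>"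
    using has_vector_derivative_Reals[OF has_wirtinger_direction[OF PQ, of "axis 1 1"]]
      has_vector_derivative_Reals[OF has_wirtinger_direction[OF PQ, of "axis 2 1"]] G_real
    by (simp_all add: zc_axis algebra_simps)
  then have "of_real (2 * Re P) = P + Q"
    by (simp add: complex_is_Real_iff complex_eq_iff)
  moreover have "P + Q = (poly (pderiv (pderiv p)) (of_real s) * poly p (of_real s) - (poly (pderiv p) (of_real s))\<^sup>2) / (poly p (of_real s))\<^sup>2"
  proof -
    have "((\<lambda>r. G (y + r *\<^sub>R axis 1 1)) has_vector_derivative P + Q) (at 0)"
      using has_wirtinger_direction[OF PQ, of "axis 1 1"] by (simp add: zc_axis)
    moreover have "G (y + r *\<^sub>R axis 1 1) = poly (pderiv p) (of_real s + of_real r) / poly p (of_real s + of_real r)" for r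
      by (simp add: G_def gline line)
    moreover have "((\<lambda>r. poly (pderiv p) (of_real s + of_real r) / poly p (of_real s + of_real r)) has_vector_derivative
       (poly (pderiv (pderiv p)) (of_real s) * poly p (of_real s) - (poly (pderiv p) (of_real s))\<^sup>2) / (poly p (of_real s))\<^sup>2) (at 0)"
    proof -
      have "poly p (of_real s) \<noteq> 0"
        using line[of 0] nz by simp
      then have "((\<lambda>h. poly (pderiv p) (of_real s + h) / poly p (of_real s + h)) has_field_derivative
          (poly (pderiv (pderiv p)) (of_real s) * poly p (of_real s) - (poly (pderiv p) (of_real s))\<^sup>2) / (poly p (of_real s))\<^sup>2)
          (at (of_real 0))"
        by (auto intro!: derivative_eq_intros simp: power2_eq_square)
      then show ?thesis
        by (rule has_vector_derivative_real_field)
    qed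
    ultimately show ?thesis
      using vector_derivative_unique_at by auto
  qed
  ultimately show ?thesis
    by metis
qed

lemma GZ_lam_off_unit_circle:
  assumes "GZ_params N lam gam" "l < 4 * N"
  shows "lam (Suc l) \<noteq> 0" "cmod (lam (Suc l)) \<noteq> 1"
  using assms by (auto simp: GZ_params_def)

lemma poly_eq_0_if_zero_on_reals:
  fixes p :: "complex poly"
  assumes "\<And>s. poly p (of_real s) = 0"
  shows "p = 0"
proof (rule ccontr)
  assume "p \<noteq> 0"
  then have "finite {z. poly p z = 0}"
    by (rule poly_roots_finite)
  moreover have "range complex_of_real \<subseteq> {z. poly p z = 0}"
    using assms by auto
  ultimately have "finite (range complex_of_real)"
    by (rule rev_finite_subset)
  then show False
    by (simp add: finite_image_iff inj_on_def infinite_UNIV_char_0)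
qed

text \<open>The real combination \<open>2 Re (w / 12 - v / 4)\<close> equals \<open>\<partial>\<^sub>1 \<partial>\<^sub>1 ln \<tau>\<close> wherever \<open>\<tau>\<close> does not vanish. For a travelling pair it agrees on
  each horizontal line with that of the translated initial state. Both restrictions of \<open>\<tau>\<close> are polynomials with the same nonzero
  leading coefficient, hence they coincide. The points where \<open>\<tau>\<close> vanishes are covered by multiplying the polynomial
  identity with \<open>p q\<close>.\<close>

lemma travelling_tau_translates:
  assumes E: "E > 0" and params: "GZ_params N lam gam"
    and travels: "travels_with (GZ_v E N lam gam) (GZ_w E N lam gam) c"
  shows "GZ_tau E N lam gam x t = GZ_tau E N lam gam (x - t *\<^sub>R c) 0"
proof -
  let ?e = "axis 1 1 :: real ^ 2" and ?tau = "GZ_tau E N lam gam"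
  define S where "S = (\<lambda>x t. Re (GZ_w E N lam gam x t / 12 - GZ_v E N lam gam x t / 4))"
  have S_eq: "of_real (2 * S (x + s *\<^sub>R ?e) t) =
      (poly (pderiv (pderiv p)) (of_real s) * poly p (of_real s) - (poly (pderiv p) (of_real s))\<^sup>2) / (poly p (of_real s))\<^sup>2"
    if p: "\<And>s. ?tau (x + s *\<^sub>R ?e) t = poly p (of_real s)" and nz: "poly p (of_real s) \<noteq> 0" for x s t p
  proof -
    let ?L = "\<lambda>y. Ln (?tau y t)" and ?y = "x + s *\<^sub>R ?e"
    have "S ?y t = Re (d_z (d_z ?L) ?y + d_z (d_zbar ?L) ?y)"
      by (simp add: S_def GZ_v_def GZ_w_def GZ_tau_def)
    moreover have "?tau (?y + r *\<^sub>R ?e) t = poly p (of_real (s + r))" for r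
      using p[of "s + r"] by (simp add: scaleR_add_left add.assoc)
    ultimately show ?thesis
      using log_second_derivative_on_line[of "\<lambda>y. ?tau y t" ?y p s, OF smooth_GZ_tau GZ_tau_ratio_real[OF params]]
        p nz by simp
  qed
  let ?lead = "\<Prod>l=0..<4*N. GZ_form E (lam (Suc l)) ?e 0"
  have lead: "?lead \<noteq> 0"
    using GZ_lam_off_unit_circle[OF params] E by (simp add: GZ_form_eq_0_iff zc_axis)
  obtain p where p0: "\<forall>s. ?tau (x + s *\<^sub>R ?e) (t + s * 0) = poly p (of_real s)"
    and p1: "coeff p (4 * N) = ?lead" "degree p \<le> 4 * N"
    using GZ_tau_along_line[of E N lam gam x ?e t 0] by blast
  obtain q where q0: "\<forall>s. ?tau ((x - t *\<^sub>R c) + s *\<^sub>R ?e) (0 + s * 0) = poly q (of_real s)"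
    and q1: "coeff q (4 * N) = ?lead" "degree q \<le> 4 * N"
    using GZ_tau_along_line[of E N lam gam "x - t *\<^sub>R c" ?e 0 0] by blast
  have p: "?tau (x + s *\<^sub>R ?e) t = poly p (of_real s)" and q: "?tau ((x - t *\<^sub>R c) + s *\<^sub>R ?e) 0 = poly q (of_real s)" for s
    using spec[OF p0, of s] spec[OF q0, of s] by simp_all
  have deg: "degree p = 4 * N" "degree q = 4 * N"
    using p1 q1 lead le_degree[of p "4*N"] le_degree[of q "4*N"] by auto
  define D where "D = (pderiv (pderiv p) * p - (pderiv p)\<^sup>2) * q\<^sup>2 - (pderiv (pderiv q) * q - (pderiv q)\<^sup>2) * p\<^sup>2"
  have zero: "poly (p * q * D) (of_real s) = 0" for s
  proof (cases "poly p (of_real s) = 0 \<or> poly q (of_real s) = 0")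
    case False
    have shift: "x + s *\<^sub>R ?e - t *\<^sub>R c = (x - t *\<^sub>R c) + s *\<^sub>R ?e"
      by simp
    obtain V W where VW: "\<And>x t. GZ_v E N lam gam x t = V (x - t *\<^sub>R c)"
      "\<And>x t. GZ_w E N lam gam x t = W (x - t *\<^sub>R c)"
      using travels unfolding travels_with_def by blast
    then have S: "S (x + s *\<^sub>R ?e) t = S ((x - t *\<^sub>R c) + s *\<^sub>R ?e) 0"
      unfolding S_def VW shift by simp
    define A B where "A = poly (pderiv (pderiv p) * p - (pderiv p)\<^sup>2) (of_real s)"
      and "B = poly (pderiv (pderiv q) * q - (pderiv q)\<^sup>2) (of_real s)"
    have "A / (poly p (of_real s))\<^sup>2 = B / (poly q (of_real s))\<^sup>2"
      using S S_eq[of x t p s, OF p] S_eq[of "x - t *\<^sub>R c" 0 q s, OF q] False by (simp add: A_def B_def)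
    then have "A * (poly q (of_real s))\<^sup>2 - B * (poly p (of_real s))\<^sup>2 = 0"
      using False by (simp add: frac_eq_eq)
    then have "poly D (of_real s) = 0"
      by (simp add: D_def A_def B_def)
    then show ?thesis
      by simp
  qed auto
  have "p * q * D = 0"
    using zero by (rule poly_eq_0_if_zero_on_reals)
  moreover have "p \<noteq> 0" "q \<noteq> 0"
    using p1 q1 lead by auto
  ultimately have "D = 0"
    by simp
  have "p = q"
    by (rule poly_eq_if_log_second_derivative_eq[OF deg])
      (use deg p1 q1 \<open>p \<noteq> 0\<close> \<open>D = 0\<close> in \<open>simp_all add: D_def\<close>)
  then show ?thesis
    using p[of 0] q[of 0] by simp
qed

text \<open>Compare leading coefficients along the rays \<open>s \<mapsto> (s u, s)\<close> and \<open>s \<mapsto> (s (u - c), 0)\<close>, on which the tau functions agree. If \<open>u\<close> is the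
  velocity attached to one parameter, the first coefficient vanishes; then a form at time 0 vanishes at \<open>u - c\<close>, which forces
  \<open>u = c\<close>.\<close>

lemma travelling_velocity:
  assumes E: "E > 0" and params: "GZ_params N lam gam"
    and travels: "travels_with (GZ_v E N lam gam) (GZ_w E N lam gam) c" and l: "l < 4 * N"
  shows "zc c = GZ_velocity E (lam (Suc l))"
proof -
  let ?tau = "GZ_tau E N lam gam"
  note nz = GZ_lam_off_unit_circle[OF params]
  obtain u where u: "zc u = GZ_velocity E (lam (Suc l))"
    using zc_surj by blast
  obtain p where p: "\<forall>s. ?tau (0 + s *\<^sub>R u) (0 + s * 1) = poly p (of_real s)"
    and p1: "coeff p (4 * N) = (\<Prod>l=0..<4*N. GZ_form E (lam (Suc l)) u 1)"
    using GZ_tau_along_line[of E N lam gam 0 u 0 1] by blast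
  obtain q where q: "\<forall>s. ?tau (0 + s *\<^sub>R (u - c)) (0 + s * 0) = poly q (of_real s)"
    and q1: "coeff q (4 * N) = (\<Prod>l=0..<4*N. GZ_form E (lam (Suc l)) (u - c) 0)"
    using GZ_tau_along_line[of E N lam gam 0 "u - c" 0 0] by blast
  have "poly (p - q) (of_real s) = 0" for s
    using travelling_tau_translates[OF E params travels, of "s *\<^sub>R u" s] spec[OF p, of s] spec[OF q, of s] by (simp add: scaleR_diff_right)
  then have "p = q"
    using poly_eq_0_if_zero_on_reals[of "p - q"] by simp
  then have "(\<Prod>l=0..<4*N. GZ_form E (lam (Suc l)) (u - c) 0) = (\<Prod>l=0..<4*N. GZ_form E (lam (Suc l)) u 1)"
    using p1 q1 by simp
  also have "\<dots> = 0"
  proof (rule prod_zero[OF finite_atLeastLessThan bexI])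
    show "GZ_form E (lam (Suc l)) u 1 = 0"
      using E nz[OF l] u by (simp add: GZ_form_eq_0_iff)
  qed (use l in simp)
  finally have "\<exists>m\<in>{0..<4*N}. GZ_form E (lam (Suc m)) (u - c) 0 = 0"
    by (simp only: prod_zero_iff finite_atLeastLessThan)
  then obtain m where "m < 4 * N" "GZ_form E (lam (Suc m)) (u - c) 0 = 0"
    by auto
  then have "zc (u - c) = 0"
    using GZ_form_eq_0_iff[OF E nz, of m "u - c" 0] by simp
  then show ?thesis
    using u by (simp add: zc_diff)
qed

lemma GZ_velocity_cubic:
  assumes "l \<noteq> 0"
  shows "poly [:- 6 * of_real E, GZ_velocity E l, - cnj (GZ_velocity E l), 6 * of_real E:] (l\<^sup>2) = 0"
  using assms by (simp add: GZ_velocity_def field_simps power2_eq_square)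

text \<open>All squares \<open>(lam j)\<^sup>2\<close> are roots of one cubic with coefficients given by \<open>c\<close> and \<open>E\<close>. Two quadruples provide
  four distinct squares, since each quadruple consists of two pairs \<open>\<plusminus>l\<close>.\<close>

lemma travelling_imp_N_eq_1:
  assumes E: "E > 0" and N: "N \<ge> 1" and params: "GZ_params N lam gam"
    and travels: "travels_with (GZ_v E N lam gam) (GZ_w E N lam gam) c"
  shows "N = 1"
proof (rule ccontr)
  assume "N \<noteq> 1"
  with N have N2: "N \<ge> 2"
    by simp
  have sub: "{1..8} \<subseteq> {1..4 * N}"
    using N2 by auto
  have inj: "lam i = lam j \<Longrightarrow> i = j" if "i \<in> {1..8}" "j \<in> {1..8}" for i j
    using params subsetD[OF sub that(1)] subsetD[OF sub that(2)] unfolding GZ_params_def by blast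
  have neg: "lam (2 * j) = - lam (2 * j - 1)" if "j \<in> {1..4}" for j
    using params that N2 unfolding GZ_params_def by auto
  \<comment> \<open>a coincidence of squares would give \<open>lam i = \<plusminus>lam (2 j - 1)\<close>, and \<open>lam (2 j)\<close> is the negative one\<close>
  have sq: "(lam i)\<^sup>2 \<noteq> (lam (2 * j - 1))\<^sup>2" if "i \<in> {1..8}" "j \<in> {1..4}" "i < 2 * j - 1" for i j
  proof
    assume "(lam i)\<^sup>2 = (lam (2 * j - 1))\<^sup>2"
    then have "lam i = lam (2 * j - 1) \<or> lam i = lam (2 * j)"
      unfolding neg[OF that(2)] by (simp only: power2_eq_iff)
    moreover have "2 * j - 1 \<in> {1..8}" "2 * j \<in> {1..8}"
      using that(2) by auto
    ultimately have "i = 2 * j - 1 \<or> i = 2 * j"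
      using inj that(1) by blast
    then show False
      using that(3) by auto
  qed
  let ?P = "[:- 6 * of_real E, zc c, - cnj (zc c), 6 * of_real E:]"
  have root: "poly ?P ((lam l)\<^sup>2) = 0" if "l \<in> {1..8}" for l
  proof -
    have m: "l - 1 < 4 * N" and l: "Suc (l - 1) = l"
      using that N2 by auto
    have "zc c = GZ_velocity E (lam l)" "lam l \<noteq> 0"
      using travelling_velocity[OF E params travels m] GZ_lam_off_unit_circle(1)[OF params m] unfolding l .
    then show ?thesis
      using GZ_velocity_cubic[of "lam l" E] by (simp only: simp_thms)
  qed
  have distinct: "(lam 1)\<^sup>2 \<noteq> (lam 3)\<^sup>2" "(lam 1)\<^sup>2 \<noteq> (lam 5)\<^sup>2" "(lam 1)\<^sup>2 \<noteq> (lam 7)\<^sup>2"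
    "(lam 3)\<^sup>2 \<noteq> (lam 5)\<^sup>2" "(lam 3)\<^sup>2 \<noteq> (lam 7)\<^sup>2" "(lam 5)\<^sup>2 \<noteq> (lam 7)\<^sup>2"
    using sq[of 1 2] sq[of 1 3] sq[of 1 4] sq[of 3 3] sq[of 3 4] sq[of 5 4] by simp_all
  have "?P \<noteq> 0"
    using E by simp
  have "card {(lam 1)\<^sup>2, (lam 3)\<^sup>2, (lam 5)\<^sup>2, (lam 7)\<^sup>2} \<le> card {z. poly ?P z = 0}"
  proof (rule card_mono[OF poly_roots_finite[OF \<open>?P \<noteq> 0\<close>]])
    have "(lam l)\<^sup>2 \<in> {z. poly ?P z = 0}" if "l \<in> {1, 3, 5, 7}" for l
      unfolding mem_Collect_eq by (rule root) (use that in auto)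
    then show "{(lam 1)\<^sup>2, (lam 3)\<^sup>2, (lam 5)\<^sup>2, (lam 7)\<^sup>2} \<subseteq> {z. poly ?P z = 0}"
      by blast
  qed
  also have "\<dots> \<le> degree ?P"
    using \<open>?P \<noteq> 0\<close> by (rule card_poly_roots_bound)
  also have "\<dots> \<le> 3"
    by (intro order_trans[OF degree_pCons_le]) simp
  finally show False
    using distinct by (simp only: card_insert_disjoint finite.intros card.empty insert_iff empty_iff simp_thms)
qed

section \<open>The soliton with one quadruple\<close>

text \<open>The evolution equation for the single soliton after clearing denominators. Here \<open>Q = a b + h\<close> is the square root of
  the tau function up to a constant, \<open>n0 / Q\<^sup>2\<close> is the normalised potential and \<open>Y / Q^5\<close> the normalised right-hand side; exchanging
  \<open>k\<close> with \<open>j\<close> and \<open>a\<close> with \<open>b\<close> is complex conjugation. The difference of both sides is a multiple of \<open>rel\<close>, which is where the precise value of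
  the additive constant \<open>h\<close> in the tau function enters.\<close>

lemma soliton_polynomial_identity:
  fixes a b k j h :: complex
  assumes rel: "h * (1 - k * j)\<^sup>2 = 2 * k * j * (1 + k * j)"
  defines "Q \<equiv> a * b + h"
  defines "n0 \<equiv> 8 * (k * b\<^sup>2 + j * a\<^sup>2 - h * (1 + k * j))"
  defines "Y \<equiv> \<lambda>k j a b. 4 * (- 6 * (16 * k * (1 + k * j)) * (k * b + a) * Q\<^sup>2 - 12 * k * (16 * k * (b + j * a)) * Q\<^sup>2
      + 18 * (16 * k * (b + j * a)) * (k * b + a)\<^sup>2 * Q + 36 * k * n0 * (k * b + a) * Q - 24 * n0 * (k * b + a)^3)
    - ((16 * k * (b + j * a) * Q - 2 * n0 * (k * b + a)) * (24 * ((k * b + a)\<^sup>2 - 2 * k * Q))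
       + n0 * (24 * (6 * k * (k * b + a) * Q - 2 * (k * b + a)^3)))
    + 4 * (24 * (6 * k * (k * b + a) * Q - 2 * (k * b + a)^3)) * Q\<^sup>2"
  shows "24 * (- (1 - k^3) * j * (16 * j * a * Q - 2 * n0 * b) + (1 - j^3) * k * (16 * k * b * Q - 2 * n0 * a)) * Q\<^sup>2
    = 2 * k * j * (Y k j a b - Y j k b a)"
proof -
  have "24 * (- (1 - k^3) * j * (16 * j * a * Q - 2 * n0 * b) + (1 - j^3) * k * (16 * k * b * Q - 2 * n0 * a)) * Q\<^sup>2
    - 2 * k * j * (Y k j a b - Y j k b a)
    = 384 * Q\<^sup>2 * (a * (k - j\<^sup>2) - b * (j - k\<^sup>2)) * (h * (1 - k * j)\<^sup>2 - 2 * k * j * (1 + k * j))"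
    unfolding Y_def n0_def Q_def by (simp add: algebra_simps power2_eq_square power3_eq_cube)
  with rel show ?thesis
    by simp
qed

text \<open>The same identity with the reciprocal \<open>r = 1 / Q\<close>, in the form in which differentiation of polynomials in \<open>r\<close> yields it.\<close>

lemma soliton_evolution_identity:
  fixes a b k j h r :: complex
  assumes rel: "h * (1 - k * j)\<^sup>2 = 2 * k * j * (1 + k * j)"
    and r: "r * (a * b + h) = 1" and "k \<noteq> 0" "j \<noteq> 0"
    and n: "n = 8 * (k * b\<^sup>2 + j * a\<^sup>2 - h * (1 + k * j))"
  defines "Z \<equiv> \<lambda>k j a b. 4 * (- 6 * (16 * k * (1 + k * j)) * (k * b + a) * r^3 - 12 * k * (16 * k * (b + j * a)) * r^3
      + 18 * (16 * k * (b + j * a)) * (k * b + a)^2 * r^4 + 36 * k * n * (k * b + a) * r^4 - 24 * n * (k * b + a)^3 * r^5)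
    - (n * r^2 * (24 * (6 * k * (k * b + a) * r^2 - 2 * (k * b + a)^3 * r^3))
       + (16 * k * (b + j * a) * r^2 - 2 * n * (k * b + a) * r^3) * (24 * ((k * b + a)^2 * r^2 - 2 * k * r)))
    + 4 * (24 * (6 * k * (k * b + a) * r^2 - 2 * (k * b + a)^3 * r^3))"
  shows "24 * ((1/k - k\<^sup>2) * (16 * j * a * r^2 - 2 * n * b * r^3) - (1/j - j\<^sup>2) * (16 * k * b * r^2 - 2 * n * a * r^3))
    = - 2 * (Z k j a b - Z j k b a)"
proof -
  define Q where "Q = a * b + h"
  have rnz: "r \<noteq> 0"
    using r by auto
  then have Q: "Q = 1 / r"
    using r by (subst nonzero_eq_divide_eq) (simp_all add: Q_def mult.commute)
  define Y where "Y = (\<lambda>k j a b. 4 * (- 6 * (16 * k * (1 + k * j)) * (k * b + a) * Q\<^sup>2 - 12 * k * (16 * k * (b + j * a)) * Q\<^sup>2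
      + 18 * (16 * k * (b + j * a)) * (k * b + a)\<^sup>2 * Q + 36 * k * n * (k * b + a) * Q - 24 * n * (k * b + a)^3)
    - ((16 * k * (b + j * a) * Q - 2 * n * (k * b + a)) * (24 * ((k * b + a)\<^sup>2 - 2 * k * Q))
       + n * (24 * (6 * k * (k * b + a) * Q - 2 * (k * b + a)^3)))
    + 4 * (24 * (6 * k * (k * b + a) * Q - 2 * (k * b + a)^3)) * Q\<^sup>2)"
  have Z: "Z k j a b = r^5 * Y k j a b" for k j a b
    using rnz by (simp add: Z_def Y_def Q algebra_simps) (simp add: numeral_eq_Suc field_simps)
  define al be where "al = 16 * j * a * Q - 2 * n * b" and "be = 16 * k * b * Q - 2 * n * a"
  have alr: "16 * j * a * r^2 - 2 * n * b * r^3 = r^3 * al" and ber: "16 * k * b * r^2 - 2 * n * a * r^3 = r^3 * be"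
    using rnz by (simp_all add: al_def be_def Q numeral_eq_Suc field_simps)
  have "24 * (- (1 - k^3) * j * al + (1 - j^3) * k * be) * Q\<^sup>2 = 2 * k * j * (Y k j a b - Y j k b a)"
    using soliton_polynomial_identity[OF rel, of a b] unfolding Y_def al_def be_def n Q_def .
  then have "r^5 * (24 * (- (1 - k^3) * j * al + (1 - j^3) * k * be) * Q\<^sup>2) = r^5 * (2 * k * j * (Y k j a b - Y j k b a))"
    by simp
  moreover have "r^5 * (24 * (- (1 - k^3) * j * al + (1 - j^3) * k * be) * Q\<^sup>2) = r^3 * (24 * (- (1 - k^3) * j * al + (1 - j^3) * k * be))"
    using rnz by (simp add: Q numeral_eq_Suc)
  moreover have "r^5 * (2 * k * j * (Y k j a b - Y j k b a)) = 2 * k * j * (Z k j a b - Z j k b a)"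
    unfolding Z by (simp add: algebra_simps)
  ultimately have main: "r^3 * (24 * (- (1 - k^3) * j * al + (1 - j^3) * k * be)) = 2 * k * j * (Z k j a b - Z j k b a)"
    by (simp only:)
  have "24 * ((1/k - k\<^sup>2) * (r^3 * al) - (1/j - j\<^sup>2) * (r^3 * be)) * (k * j) =
      - (r^3 * (24 * (- (1 - k^3) * j * al + (1 - j^3) * k * be)))"
    using \<open>k \<noteq> 0\<close> \<open>j \<noteq> 0\<close> by (simp add: field_simps power2_eq_square power3_eq_cube)
  also have "\<dots> = - (2 * k * j * (Z k j a b - Z j k b a))"
    unfolding main ..
  finally have "24 * ((1/k - k\<^sup>2) * (r^3 * al) - (1/j - j\<^sup>2) * (r^3 * be)) * (k * j) = - 2 * (Z k j a b - Z j k b a) * (k * j)"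
    by (simp add: algebra_simps)
  then show ?thesis
    unfolding alr ber using \<open>k \<noteq> 0\<close> \<open>j \<noteq> 0\<close> by simp
qed

text \<open>The soliton calculation iterates \<open>d_z\<close> three times; recording only this half of the derivative keeps the intermediate
  expressions small.\<close>

definition has_dz :: "(real ^ 2 \<Rightarrow> complex) \<Rightarrow> complex \<Rightarrow> real ^ 2 \<Rightarrow> bool" where
  "has_dz f p x \<longleftrightarrow> (\<exists>q. has_wirtinger f p q x)"

lemma has_dz_imp: "(\<And>x. has_dz f (p x) x) \<Longrightarrow> d_z f = p"
  by (auto simp: has_dz_def fun_eq_iff dest: has_wirtinger_imp)

lemma has_dz_const: "has_dz (\<lambda>_. c) 0 x"
  unfolding has_dz_def using has_wirtinger_const by blast

lemma has_dz_add: "has_dz f p x \<Longrightarrow> has_dz g q x \<Longrightarrow> has_dz (\<lambda>y. f y + g y) (p + q) x"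
  unfolding has_dz_def using has_wirtinger_add by blast

lemma has_dz_diff: "has_dz f p x \<Longrightarrow> has_dz g q x \<Longrightarrow> has_dz (\<lambda>y. f y - g y) (p - q) x"
  unfolding has_dz_def using has_wirtinger_diff by blast

lemma has_dz_mult: "has_dz f p x \<Longrightarrow> has_dz g q x \<Longrightarrow> has_dz (\<lambda>y. f y * g y) (f x * q + p * g x) x"
  unfolding has_dz_def using has_wirtinger_mult by blast

lemma has_dz_power: "has_dz f p x \<Longrightarrow> has_dz (\<lambda>y. f y ^ n) (of_nat n * f x ^ (n - 1) * p) x"
  unfolding has_dz_def
  using has_wirtinger_compose_deriv[of f p _ x "\<lambda>z. z ^ n" "of_nat n * f x ^ (n - 1)"] DERIV_power[OF DERIV_ident, of n "f x" UNIV]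
  by (auto simp: mult.commute)

lemmas has_dz_rules = has_dz_const has_dz_add has_dz_diff has_dz_mult has_dz_power

text \<open>For a single quadruple with first member \<open>l\<close> put \<open>k = 1 / l\<^sup>2\<close>. The tau function is then, up to a constant factor,
  \<open>(\<bar>a\<bar>\<^sup>2 + h)\<^sup>2\<close> with an affine function \<open>a\<close> of \<open>(x, t)\<close> and \<open>h\<close> equal to the following number.\<close>

definition soliton_shift :: "complex \<Rightarrow> real" where
  "soliton_shift k = 2 * (cmod k)\<^sup>2 * (1 + (cmod k)\<^sup>2) / (1 - (cmod k)\<^sup>2)\<^sup>2"

definition soliton_Q :: "complex \<Rightarrow> complex \<Rightarrow> complex" where
  "soliton_Q k a = a * cnj a + of_real (soliton_shift k)"

definition soliton_num :: "complex \<Rightarrow> complex \<Rightarrow> complex" where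
  "soliton_num k a = 8 * (k * (cnj a)\<^sup>2 + cnj k * a\<^sup>2 - of_real (soliton_shift k) * (1 + k * cnj k))"

definition soliton_v :: "complex \<Rightarrow> complex \<Rightarrow> complex" where
  "soliton_v k a = soliton_num k a / (soliton_Q k a)\<^sup>2"

definition soliton_w :: "complex \<Rightarrow> complex \<Rightarrow> complex" where
  "soliton_w k a = 24 * ((k * cnj a + a)\<^sup>2 - 2 * k * soliton_Q k a) / (soliton_Q k a)\<^sup>2"

lemma soliton_shift_pos: "k \<noteq> 0 \<Longrightarrow> cmod k \<noteq> 1 \<Longrightarrow> soliton_shift k > 0"
  unfolding soliton_shift_def using cmod_power2_neq_1[of k]
  by (intro divide_pos_pos mult_pos_pos) (auto intro: add_pos_nonneg)

lemma soliton_shift_rel: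
  assumes "cmod k \<noteq> 1"
  shows "of_real (soliton_shift k) * (1 - k * cnj k)\<^sup>2 = 2 * k * cnj k * (1 + k * cnj k)"
proof -
  have kk: "k * cnj k = of_real ((cmod k)\<^sup>2)"
    by (simp only: complex_norm_square)
  have "soliton_shift k * (1 - (cmod k)\<^sup>2)\<^sup>2 = 2 * (cmod k)\<^sup>2 * (1 + (cmod k)\<^sup>2)"
    using cmod_power2_neq_1[OF assms] by (simp add: soliton_shift_def)
  then have "complex_of_real (soliton_shift k * (1 - (cmod k)\<^sup>2)\<^sup>2) = of_real (2 * (cmod k)\<^sup>2 * (1 + (cmod k)\<^sup>2))"
    by (simp only:)
  then show ?thesis
    unfolding mult.assoc[of 2] kk by simp
qed

lemma soliton_Q_eq: "soliton_Q k a = of_real ((cmod a)\<^sup>2 + soliton_shift k)"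
  by (simp add: soliton_Q_def complex_norm_square flip: of_real_power)

lemma soliton_Q_nonzero:
  assumes "soliton_shift k > 0"
  shows "soliton_Q k a \<noteq> 0"
proof -
  have "(cmod a)\<^sup>2 + soliton_shift k > 0"
    using assms by (simp add: add_nonneg_pos)
  then show ?thesis
    unfolding soliton_Q_eq of_real_eq_0_iff by linarith
qed

lemma cnj_soliton_v: "cnj (soliton_v k a) = soliton_v k a"
  by (simp add: soliton_v_def soliton_num_def soliton_Q_def algebra_simps)

text \<open>A function \<open>A\<close> that is affine in the plane, with \<open>D = - i e\<close> for a real \<open>e\<close>. The functions \<open>u\<close> and \<open>ub\<close> are \<open>d_z Q\<close> and \<open>d_zbar Q\<close> up to the
  factors \<open>D\<close> and \<open>- D\<close>. Both potentials are polynomials in \<open>A\<close>, its conjugate and the reciprocal \<open>r\<close>, so all derivatives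
  below stay polynomial.\<close>

locale soliton =
  fixes k D :: complex and A :: "real ^ 2 \<Rightarrow> complex"
  assumes k_nz: "k \<noteq> 0" and k_norm: "cmod k \<noteq> 1" and D_imag: "cnj D = - D"
    and wA: "has_wirtinger A (D * k) (- D) x"
begin

definition "B x = cnj (A x)"
definition "u x = k * B x + A x"
definition "ub x = B x + cnj k * A x"
definition "Q x = soliton_Q k (A x)"
definition "r x = 1 / Q x"
definition "n x = soliton_num k (A x)"
abbreviation "h \<equiv> complex_of_real (soliton_shift k)"

lemma Q_nz: "Q x \<noteq> 0"
  unfolding Q_def using soliton_Q_nonzero soliton_shift_pos k_nz k_norm by blast

lemma wB: "has_wirtinger B D (- D * cnj k) x"
proof -
  have "((\<lambda>x. cnj (A x)) has_derivative (\<lambda>h. cnj (D * k * zc h + - D * cnj (zc h)))) (at x)"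
    using bounded_linear.has_derivative[OF bounded_linear_cnj wA[unfolded has_wirtinger_def]] by simp
  then show ?thesis
    by (simp add: has_wirtinger_def B_def[abs_def] D_imag algebra_simps)
qed

lemma wQ: "has_wirtinger Q (D * u x) (- D * ub x) x"
proof -
  have "Q = (\<lambda>x. A x * B x + h)"
    by (simp add: fun_eq_iff Q_def soliton_Q_def B_def)
  with has_wirtinger_add[OF has_wirtinger_mult[OF wA wB] has_wirtinger_const[of h]] show ?thesis
    by (simp add: u_def ub_def algebra_simps)
qed

lemma wu: "has_wirtinger u (2 * k * D) (- D * (1 + k * cnj k)) x"
  using has_wirtinger_add[OF has_wirtinger_cmult[OF wB, of k] wA] by (simp add: u_def[abs_def] algebra_simps)

lemma wub: "has_wirtinger ub (D * (1 + k * cnj k)) (- 2 * cnj k * D) x"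
  using has_wirtinger_add[OF wB has_wirtinger_cmult[OF wA, of "cnj k"]] by (simp add: ub_def[abs_def] algebra_simps)

lemma wr: "has_wirtinger r (- D * u x * r x ^ 2) (D * ub x * r x ^ 2) x"
  using has_wirtinger_divide[OF has_wirtinger_const[of 1] wQ Q_nz]
  by (simp add: r_def[abs_def] power_divide)

lemma n_eq: "n x = 8 * (u x * ub x - (1 + k * cnj k) * Q x)"
  by (simp add: n_def soliton_num_def u_def ub_def Q_def soliton_Q_def B_def algebra_simps power2_eq_square)

lemma v_eq: "soliton_v k (A x) = n x * r x ^ 2" and w_eq: "soliton_w k (A x) = 24 * (u x ^ 2 * r x ^ 2 - 2 * k * r x)"
  using Q_nz[of x]
  by (simp_all add: soliton_v_def soliton_w_def n_def r_def Q_def u_def B_def field_simps power2_eq_square)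

lemma du: "has_dz u (2 * k * D) x"
  and dub: "has_dz ub (D * (1 + k * cnj k)) x"
  and dr: "has_dz r (- D * u x * r x ^ 2) x" and dQ: "has_dz Q (D * u x) x"
  unfolding has_dz_def using wu wr wQ wub by blast+

lemma dn: "has_dz n (D * (16 * k * ub x)) x"
proof -
  have "n = (\<lambda>x. 8 * (u x * ub x - (1 + k * cnj k) * Q x))"
    by (simp add: n_eq fun_eq_iff)
  moreover have "has_dz (\<lambda>x. 8 * (u x * ub x - (1 + k * cnj k) * Q x))
      (8 * (u x * (D * (1 + k * cnj k)) + 2 * k * D * ub x - ((1 + k * cnj k) * (D * u x) + 0 * Q x)) + 0 * (u x * ub x - (1 + k * cnj k) * Q x)) x"
    by (intro has_dz_rules du dub dQ)
  ultimately show ?thesis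
    by (simp add: algebra_simps)
qed

lemma has_dz_eq: "has_dz f p x \<Longrightarrow> p = p' \<Longrightarrow> has_dz f p' x"
  by simp

lemma d_z_v: "d_z (\<lambda>x. n x * r x ^ 2) = (\<lambda>x. D * (16 * k * ub x * r x ^ 2 - 2 * n x * u x * r x ^ 3))"
  by (rule has_dz_imp, rule has_dz_eq, (rule has_dz_rules dn dr)+)
    (simp add: algebra_simps power2_eq_square power3_eq_cube)

lemma dw: "has_dz (\<lambda>x. 24 * (u x ^ 2 * r x ^ 2 - 2 * k * r x)) (D * (24 * (6 * k * u x * r x ^ 2 - 2 * u x ^ 3 * r x ^ 3))) x"
  by (rule has_dz_eq, (rule has_dz_rules dr du)+)
    (simp add: algebra_simps numeral_eq_Suc)

lemma dv: "has_dz (\<lambda>x. n x * r x ^ 2) (D * (16 * k * ub x * r x ^ 2 - 2 * n x * u x * r x ^ 3)) x"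
  by (rule has_dz_eq, (rule has_dz_rules dn dr)+)
    (simp add: algebra_simps power2_eq_square power3_eq_cube)

text \<open>Both sides become polynomials in \<open>u\<close>, \<open>ub\<close> and \<open>r\<close> once \<open>n\<close> is written as \<open>8 (u ub - (1 + k cnj k) Q)\<close> and \<open>Q r = 1\<close> is used.\<close>

lemma d_zbar_w: "d_zbar (\<lambda>x. 24 * (u x ^ 2 * r x ^ 2 - 2 * k * r x)) x = - 3 * d_z (\<lambda>x. n x * r x ^ 2) x"
proof -
  let ?q = "- 2 * D * (1 + k * cnj k) * u x * r x ^ 2 + 2 * D * ub x * u x ^ 2 * r x ^ 3 - 2 * D * k * ub x * r x ^ 2"
  have "has_wirtinger (\<lambda>x. 24 * ((u x * r x) * (u x * r x) - 2 * k * r x))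
      (24 * ((u x * r x) * (u x * (- D * u x * r x ^ 2) + 2 * k * D * r x)
        + (u x * (- D * u x * r x ^ 2) + 2 * k * D * r x) * (u x * r x) - 2 * k * (- D * u x * r x ^ 2)))
      (24 * ((u x * r x) * (u x * (D * ub x * r x ^ 2) + (- D * (1 + k * cnj k)) * r x)
        + (u x * (D * ub x * r x ^ 2) + (- D * (1 + k * cnj k)) * r x) * (u x * r x) - 2 * k * (D * ub x * r x ^ 2))) x"
    by (intro has_wirtinger_cmult has_wirtinger_diff has_wirtinger_mult wu wr)
  from has_wirtinger_imp(2)[OF this] have w: "d_zbar (\<lambda>x. 24 * (u x ^ 2 * r x ^ 2 - 2 * k * r x)) x = 24 * ?q"
    by (simp add: algebra_simps power2_eq_square power3_eq_cube)
  have "n x * r x ^ 3 = 8 * (u x * ub x * r x ^ 3 - (1 + k * cnj k) * r x ^ 2)"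
    using Q_nz[of x] by (simp add: n_eq r_def field_simps power2_eq_square power3_eq_cube)
  then have "D * (16 * k * ub x * r x ^ 2 - 2 * n x * u x * r x ^ 3) =
      D * (16 * k * ub x * r x ^ 2 - 2 * u x * (8 * (u x * ub x * r x ^ 3 - (1 + k * cnj k) * r x ^ 2)))"
    by (simp add: mult.left_commute)
  then have v: "d_z (\<lambda>x. n x * r x ^ 2) x =
      D * (16 * k * ub x * r x ^ 2 - 2 * u x * (8 * (u x * ub x * r x ^ 3 - (1 + k * cnj k) * r x ^ 2)))"
    unfolding d_z_v .
  show ?thesis
    unfolding v w by (simp add: algebra_simps power2_eq_square)
qed

lemma cnj_r: "cnj (r x) = r x" and cnj_n: "cnj (n x) = n x"
  by (simp_all add: r_def Q_def soliton_Q_eq n_def soliton_num_def algebra_simps)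

text \<open>\<open>T\<close> is the time derivative of the affine function \<open>A\<close>, so the right-hand side is the time derivative of the potential. Writing
  \<open>X\<close> for the expression under the real part, \<open>4 Re X = 2 (X + cnj X)\<close>, and \<open>X\<close> is \<open>- D e^4\<close> times the polynomial \<open>Z\<close> of the
  identity above, since \<open>D\<^sup>2 = - e\<^sup>2\<close> and \<open>D\<close> is imaginary.\<close>

lemma evolution:
  fixes e :: real
  assumes D: "D = - \<i> * of_real e"
  defines "T \<equiv> 24 * D * (of_real e)\<^sup>2 * (1 / k - k\<^sup>2)"
    and "v \<equiv> \<lambda>x. (of_real e)\<^sup>2 * soliton_v k (A x)" and "w \<equiv> \<lambda>x. (of_real e)\<^sup>2 * soliton_w k (A x)"
  shows "of_real (4 * Re (4 * d_z (d_z (d_z v)) x + d_z (\<lambda>y. v y * w y) x - of_real (4 * e\<^sup>2) * d_z w x)) =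
    (of_real e)\<^sup>2 * (16 * (k * B x * cnj T + cnj k * A x * T) * r x ^ 2 - 2 * n x * (A x * cnj T + B x * T) * r x ^ 3)"
proof -
  let ?e = "of_real e :: complex"
  let ?v1 = "\<lambda>x. 16 * k * ub x * r x ^ 2 - 2 * n x * u x * r x ^ 3"
  let ?v2 = "\<lambda>x. 16 * k * (1 + k * cnj k) * r x ^ 2 - 4 * (16 * k * ub x) * u x * r x ^ 3
      - 4 * k * n x * r x ^ 3 + 6 * n x * u x ^ 2 * r x ^ 4"
  let ?v3 = "\<lambda>x. - 6 * (16 * k * (1 + k * cnj k)) * u x * r x ^ 3 - 12 * k * (16 * k * ub x) * r x ^ 3
      + 18 * (16 * k * ub x) * u x ^ 2 * r x ^ 4 + 36 * k * n x * u x * r x ^ 4 - 24 * n x * u x ^ 3 * r x ^ 5"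
  let ?w = "\<lambda>x. 24 * (u x ^ 2 * r x ^ 2 - 2 * k * r x)"
  let ?w1 = "\<lambda>x. 24 * (6 * k * u x * r x ^ 2 - 2 * u x ^ 3 * r x ^ 3)"
  define Z where "Z = (\<lambda>k j a b. 4 * (- 6 * (16 * k * (1 + k * j)) * (k * b + a) * r x^3 - 12 * k * (16 * k * (b + j * a)) * r x^3
      + 18 * (16 * k * (b + j * a)) * (k * b + a)^2 * r x^4 + 36 * k * n x * (k * b + a) * r x^4 - 24 * n x * (k * b + a)^3 * r x^5)
    - (n x * r x^2 * (24 * (6 * k * (k * b + a) * r x^2 - 2 * (k * b + a)^3 * r x^3))
       + (16 * k * (b + j * a) * r x^2 - 2 * n x * (k * b + a) * r x^3) * (24 * ((k * b + a)^2 * r x^2 - 2 * k * r x)))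
    + 4 * (24 * (6 * k * (k * b + a) * r x^2 - 2 * (k * b + a)^3 * r x^3)))"
  define X where "X = 4 * d_z (d_z (d_z v)) x + d_z (\<lambda>y. v y * w y) x - of_real (4 * e\<^sup>2) * d_z w x"
  have v: "v = (\<lambda>x. ?e\<^sup>2 * (n x * r x ^ 2))" and w: "w = (\<lambda>x. ?e\<^sup>2 * ?w x)"
    by (simp_all add: v_def w_def v_eq w_eq fun_eq_iff)
  have scale: "d_z (\<lambda>x. c * f x) = (\<lambda>x. c * p x)" if "\<And>x. has_dz f (p x) x" for c f p
    by (rule has_dz_imp, rule has_dz_eq, (rule has_dz_rules that)+) simp
  have dv1: "has_dz (\<lambda>x. D * ?v1 x) (D\<^sup>2 * ?v2 x) x" for x
    by (rule has_dz_eq, (rule has_dz_rules dn dr du dub)+)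
      (simp add: algebra_simps power2_eq_square power3_eq_cube power4_eq_xxxx)
  have dv2: "has_dz (\<lambda>x. D\<^sup>2 * ?v2 x) (D ^ 3 * ?v3 x) x" for x
    by (rule has_dz_eq, (rule has_dz_rules dn dr du dub)+) (simp add: algebra_simps numeral_eq_Suc)
  have v3: "d_z (d_z (d_z v)) x = ?e\<^sup>2 * (D ^ 3 * ?v3 x)"
    unfolding v scale[OF dv] scale[OF dv1] scale[OF dv2] ..
  have "d_z (\<lambda>y. v y * w y) = (\<lambda>x. ?e\<^sup>2 * ?e\<^sup>2 * (n x * r x ^ 2 * (D * ?w1 x) + D * ?v1 x * ?w x))"
    using scale[OF has_dz_mult[OF dv dw], of "?e\<^sup>2 * ?e\<^sup>2"] unfolding v w by (simp only: mult_ac)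
  then have vw: "d_z (\<lambda>y. v y * w y) x = ?e\<^sup>2 * ?e\<^sup>2 * (n x * r x ^ 2 * (D * ?w1 x) + D * ?v1 x * ?w x)"
    by (simp only:)
  have w1: "d_z w x = ?e\<^sup>2 * (D * ?w1 x)"
    unfolding w scale[OF dw] ..
  have D2: "D\<^sup>2 = - ?e\<^sup>2"
    by (simp add: D power_mult_distrib)
  \<comment> \<open>the cubic power of \<open>D\<close> is reduced by \<open>D\<^sup>2 = - e\<^sup>2\<close>, so that one common factor \<open>- D e^4\<close> remains\<close>
  have comb: "4 * (?e\<^sup>2 * (D ^ 3 * V3)) + ?e\<^sup>2 * ?e\<^sup>2 * (N * (D * W1) + D * V1 * W) - of_real (4 * e\<^sup>2) * (?e\<^sup>2 * (D * W1))
      = - D * ?e ^ 4 * (4 * V3 - (N * W1 + V1 * W) + 4 * W1)" for V3 N W1 V1 W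
  proof -
    have "D ^ 3 = - ?e\<^sup>2 * D"
      using D2 by (simp add: power3_eq_cube power2_eq_square)
    then show ?thesis
      by (simp add: algebra_simps power2_eq_square power4_eq_xxxx)
  qed
  have X: "X = - D * ?e ^ 4 * Z k (cnj k) (A x) (B x)"
    unfolding X_def v3 vw w1 comb by (simp add: Z_def u_def ub_def)
  have "cnj (Z k (cnj k) (A x) (B x)) = Z (cnj k) k (B x) (A x)"
    by (simp add: Z_def cnj_r cnj_n B_def)
  then have "cnj X = D * ?e ^ 4 * Z (cnj k) k (B x) (A x)"
    unfolding X by (simp add: D_imag)
  moreover have "of_real (4 * Re X) = 2 * (X + cnj X)"
    by (simp add: complex_eq_iff)
  ultimately have "of_real (4 * Re X) = D * ?e ^ 4 * (- 2 * (Z k (cnj k) (A x) (B x) - Z (cnj k) k (B x) (A x)))"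
    unfolding X by (simp add: algebra_simps)
  also have "- 2 * (Z k (cnj k) (A x) (B x) - Z (cnj k) k (B x) (A x)) =
      24 * ((1/k - k\<^sup>2) * (16 * cnj k * A x * r x^2 - 2 * n x * B x * r x^3)
        - (1/cnj k - (cnj k)\<^sup>2) * (16 * k * B x * r x^2 - 2 * n x * A x * r x^3))"
    unfolding Z_def
  proof (rule soliton_evolution_identity[symmetric, where h = h])
    show "h * (1 - k * cnj k)\<^sup>2 = 2 * k * cnj k * (1 + k * cnj k)"
      by (rule soliton_shift_rel[OF k_norm])
    show "r x * (A x * B x + h) = 1"
      using Q_nz[of x] by (simp add: r_def Q_def soliton_Q_def B_def)
    show "n x = 8 * (k * (B x)\<^sup>2 + cnj k * (A x)\<^sup>2 - h * (1 + k * cnj k))"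
      by (simp add: n_def soliton_num_def B_def)
  qed (use k_nz in simp_all)
  finally have "of_real (4 * Re X) = D * ?e ^ 4 * (24 * ((1/k - k\<^sup>2) * (16 * cnj k * A x * r x^2 - 2 * n x * B x * r x^3)
        - (1/cnj k - (cnj k)\<^sup>2) * (16 * k * B x * r x^2 - 2 * n x * A x * r x^3)))" .
  moreover have "cnj T = - 24 * D * ?e\<^sup>2 * (1 / cnj k - (cnj k)\<^sup>2)"
    by (simp add: T_def D_imag)
  moreover have "D * ?e ^ 4 * (24 * (K * (16 * j * a * R2 - 2 * N * b * R3) - J * (16 * k * b * R2 - 2 * N * a * R3))) =
      ?e\<^sup>2 * (16 * (k * b * (- 24 * D * ?e\<^sup>2 * J) + j * a * (24 * D * ?e\<^sup>2 * K)) * R2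
        - 2 * N * (a * (- 24 * D * ?e\<^sup>2 * J) + b * (24 * D * ?e\<^sup>2 * K)) * R3)" for K J j a b R2 R3 N
    by (simp add: algebra_simps power2_eq_square power4_eq_xxxx)
  ultimately show ?thesis
    unfolding X_def T_def by (simp only:)
qed

text \<open>The logarithm of \<open>c Q\<^sup>2\<close> has first derivatives \<open>2 D u r\<close> and \<open>- 2 D ub r\<close>; one more differentiation gives the two
  potentials.\<close>

lemma log_derivatives_square:
  assumes "c \<noteq> 0"
  defines "L \<equiv> \<lambda>y. Ln (c * Q y ^ 2)"
  shows "- 4 * d_z (d_zbar L) x = - D\<^sup>2 * soliton_v k (A x)"
    and "12 * d_z (d_z L) x = - D\<^sup>2 * soliton_w k (A x)"
proof -
  have "has_wirtinger L (2 * D * (u y * r y)) (- 2 * D * (ub y * r y)) y" for y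
  proof -
    have "has_wirtinger (\<lambda>y. c * (Q y * Q y)) (c * (Q y * (D * u y) + D * u y * Q y))
        (c * (Q y * (- D * ub y) + - D * ub y * Q y)) y"
      by (intro has_wirtinger_cmult has_wirtinger_mult wQ)
    moreover have "c * (Q y * Q y) \<noteq> 0"
      using assms(1) Q_nz by simp
    moreover have "c * (Q z * Q z) / (c * (Q y * Q y)) \<in> \<real>" for z
      using assms(1) by (simp add: Q_def soliton_Q_eq flip: of_real_mult of_real_divide)
    ultimately have "has_wirtinger (\<lambda>y. Ln (c * (Q y * Q y))) ((c * (Q y * (D * u y) + D * u y * Q y)) / (c * (Q y * Q y)))
        ((c * (Q y * (- D * ub y) + - D * ub y * Q y)) / (c * (Q y * Q y))) y"
      by (rule has_wirtinger_Ln)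
    moreover have "(c * (Q y * (D * u y) + D * u y * Q y)) / (c * (Q y * Q y)) = 2 * D * (u y * r y)"
      "(c * (Q y * (- D * ub y) + - D * ub y * Q y)) / (c * (Q y * Q y)) = - 2 * D * (ub y * r y)"
      using assms(1) Q_nz[of y] by (simp_all add: r_def)
    ultimately show ?thesis
      by (simp only: L_def power2_eq_square)
  qed
  note L = has_wirtinger_imp[OF this]
  have "d_z L = (\<lambda>y. 2 * D * (u y * r y))" "d_zbar L = (\<lambda>y. - 2 * D * (ub y * r y))"
    using L by (simp_all add: fun_eq_iff)
  moreover have "d_z (\<lambda>y. 2 * D * (u y * r y)) = (\<lambda>x. 2 * D * (u x * (- D * u x * r x ^ 2) + 2 * k * D * r x))"
    by (rule has_dz_imp, rule has_dz_eq, (rule has_dz_rules du dr)+) simp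
  moreover have "d_z (\<lambda>y. - 2 * D * (ub y * r y)) = (\<lambda>x. - 2 * D * (ub x * (- D * u x * r x ^ 2) + D * (1 + k * cnj k) * r x))"
    by (rule has_dz_imp, rule has_dz_eq, (rule has_dz_rules dub dr)+) simp
  moreover have nr: "n x * r x ^ 2 = 8 * (u x * ub x * r x ^ 2 - (1 + k * cnj k) * r x)"
    using Q_nz[of x] by (simp add: n_eq r_def field_simps power2_eq_square)
  ultimately show "- 4 * d_z (d_zbar L) x = - D\<^sup>2 * soliton_v k (A x)" "12 * d_z (d_z L) x = - D\<^sup>2 * soliton_w k (A x)"
    unfolding v_eq w_eq nr by (simp_all add: algebra_simps power2_eq_square)
qed

end

section \<open>The pair with a single quadruple\<close>

lemma smooth_soliton:
  assumes "k \<noteq> 0" "cmod k \<noteq> 1" "smooth f"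
  shows "smooth (\<lambda>y. soliton_v k (f y))" "smooth (\<lambda>y. soliton_w k (f y))"
proof -
  have Q: "smooth (\<lambda>y. soliton_Q k (f y))"
    unfolding soliton_Q_def
    by (intro smooth_add smooth_mult smooth_const assms(3) smooth_bounded_linear_compose[OF bounded_linear_cnj])
  have nz: "(soliton_Q k (f y))\<^sup>2 \<noteq> 0" for y
    using soliton_Q_nonzero[OF soliton_shift_pos[OF assms(1,2)]] by simp
  show "smooth (\<lambda>y. soliton_v k (f y))" "smooth (\<lambda>y. soliton_w k (f y))"
    unfolding soliton_v_def soliton_w_def soliton_num_def
    by (intro smooth_divide smooth_power smooth_add smooth_diff smooth_mult smooth_const Q nz assms(3)
        smooth_bounded_linear_compose[OF bounded_linear_cnj])+
qed

text \<open>The denominator is the square of \<open>\<bar>a\<bar>\<^sup>2 + h\<close>, so a numerator of at most that order leaves one power for decay.\<close>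

lemma soliton_quotient_tendsto_0:
  assumes "filterlim (\<lambda>x. cmod (a x)) at_top F" "soliton_shift k > 0"
    and bound: "\<And>z. cmod (m z) \<le> C * ((cmod z)\<^sup>2 + soliton_shift k)"
  shows "((\<lambda>x. m (a x) / (soliton_Q k (a x))\<^sup>2) \<longlongrightarrow> 0) F"
proof (rule Lim_null_comparison)
  have "filterlim (\<lambda>x. (cmod (a x))\<^sup>2 + soliton_shift k) at_top F"
  proof (rule filterlim_at_top_mono)
    show "filterlim (\<lambda>x. (cmod (a x))\<^sup>2) at_top F"
      using assms(1) by (intro filterlim_pow_at_top) simp_all
  qed (use assms(2) in simp)
  then show "((\<lambda>x. C / ((cmod (a x))\<^sup>2 + soliton_shift k)) \<longlongrightarrow> 0) F"
    by (intro tendsto_divide_0[OF tendsto_const] filterlim_at_top_imp_at_infinity)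
  show "\<forall>\<^sub>F x in F. cmod (m (a x) / (soliton_Q k (a x))\<^sup>2) \<le> C / ((cmod (a x))\<^sup>2 + soliton_shift k)"
  proof (rule always_eventually, rule allI)
    fix x
    define q where "q = (cmod (a x))\<^sup>2 + soliton_shift k"
    have q: "q > 0"
      using assms(2) by (simp add: q_def add_nonneg_pos)
    have "cmod (m (a x) / (soliton_Q k (a x))\<^sup>2) = cmod (m (a x)) / q\<^sup>2"
      unfolding soliton_Q_eq q_def[symmetric] using q by (simp add: norm_divide norm_power)
    also have "\<dots> \<le> C * q / q\<^sup>2"
      using bound[of "a x"] by (intro divide_right_mono) (simp_all add: q_def)
    also have "\<dots> = C / q"
      using q by (simp add: power2_eq_square)
    finally show "cmod (m (a x) / (soliton_Q k (a x))\<^sup>2) \<le> C / ((cmod (a x))\<^sup>2 + soliton_shift k)"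
      by (simp add: q_def)
  qed
qed

lemma soliton_tendsto_0:
  assumes "k \<noteq> 0" "cmod k \<noteq> 1" "filterlim (\<lambda>x. cmod (a x)) at_top F"
  shows "((\<lambda>x. soliton_v k (a x)) \<longlongrightarrow> 0) F" "((\<lambda>x. soliton_w k (a x)) \<longlongrightarrow> 0) F"
proof -
  note h = soliton_shift_pos[OF assms(1,2)]
  have "cmod (soliton_num k z) \<le> 8 * (2 * cmod k + (1 + (cmod k)\<^sup>2)) * ((cmod z)\<^sup>2 + soliton_shift k)" for z
  proof -
    have "cmod (k * (cnj z)\<^sup>2 + cnj k * z\<^sup>2 - of_real (soliton_shift k) * (1 + k * cnj k)) \<le>
        cmod (k * (cnj z)\<^sup>2) + cmod (cnj k * z\<^sup>2) + cmod (of_real (soliton_shift k) * (1 + k * cnj k))"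
      by (meson norm_triangle_ineq norm_triangle_ineq4 order_trans add_right_mono)
    also have "\<dots> \<le> cmod k * (cmod z)\<^sup>2 + cmod k * (cmod z)\<^sup>2 + soliton_shift k * (1 + (cmod k)\<^sup>2)"
      using h norm_triangle_ineq[of 1 "k * cnj k"] by (simp add: norm_mult norm_power power2_eq_square)
    also have "\<dots> \<le> (2 * cmod k + (1 + (cmod k)\<^sup>2)) * ((cmod z)\<^sup>2 + soliton_shift k)"
      using h by (simp add: algebra_simps)
    finally show ?thesis
      unfolding soliton_num_def norm_mult[of 8] norm_numeral mult.assoc[of 8] by (rule mult_left_mono) simp
  qed
  from soliton_quotient_tendsto_0[OF assms(3) h this]
  show "((\<lambda>x. soliton_v k (a x)) \<longlongrightarrow> 0) F"
    by (simp add: soliton_v_def)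
  have "cmod (24 * ((k * cnj z + z)\<^sup>2 - 2 * k * soliton_Q k z)) \<le>
      24 * ((cmod k + 1)\<^sup>2 + 2 * cmod k) * ((cmod z)\<^sup>2 + soliton_shift k)" for z
  proof -
    have "cmod (k * cnj z + z) \<le> (cmod k + 1) * cmod z"
      using norm_triangle_ineq[of "k * cnj z" z] by (simp add: norm_mult algebra_simps)
    then have "(cmod (k * cnj z + z))\<^sup>2 \<le> (cmod k + 1)\<^sup>2 * (cmod z)\<^sup>2"
      by (metis power_mono norm_ge_zero power_mult_distrib)
    moreover have "(cmod k + 1)\<^sup>2 * (cmod z)\<^sup>2 \<le> (cmod k + 1)\<^sup>2 * ((cmod z)\<^sup>2 + soliton_shift k)"
      using h by (intro mult_left_mono) simp_all
    moreover have "cmod (2 * k * soliton_Q k z) = 2 * cmod k * ((cmod z)\<^sup>2 + soliton_shift k)"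
      using h unfolding soliton_Q_eq norm_mult norm_of_real by simp
    moreover have "cmod ((k * cnj z + z)\<^sup>2 - 2 * k * soliton_Q k z) \<le> (cmod (k * cnj z + z))\<^sup>2 + cmod (2 * k * soliton_Q k z)"
      using norm_triangle_ineq4[of "(k * cnj z + z)\<^sup>2" "2 * k * soliton_Q k z"] by (simp only: norm_power)
    ultimately have "cmod ((k * cnj z + z)\<^sup>2 - 2 * k * soliton_Q k z) \<le>
        ((cmod k + 1)\<^sup>2 + 2 * cmod k) * ((cmod z)\<^sup>2 + soliton_shift k)"
      by (simp only: distrib_right)
    then show ?thesis
      unfolding norm_mult[of 24] norm_numeral mult.assoc[of 24] by (rule mult_left_mono) simp
  qed
  from soliton_quotient_tendsto_0[OF assms(3) h this]
  show "((\<lambda>x. soliton_w k (a x)) \<longlongrightarrow> 0) F"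
    by (simp add: soliton_w_def)
qed

text \<open>The determinant of the \<open>4 \<times> 4\<close> matrix formed by two pairs \<open>\<plusminus>l\<close>, \<open>\<plusminus>m\<close>, written out. Each diagonal block has determinant \<open>al\<^sup>2\<close>,
  respectively \<open>be\<^sup>2\<close>, because the shift \<open>p = 1 / (2 l)\<close> between its diagonal entries matches its off-diagonal entries.\<close>

lemma det_two_pairs:
  fixes al be p q X Y :: complex
  shows "(al - p) * ((al + p) * ((be - q) * (be + q) - (- q) * q) - Y * (- Y * (be + q) - (- q) * (- X)) + X * (- Y * q - (be - q) * (- X)))
    - (- p) * (p * ((be - q) * (be + q) - (- q) * q) - Y * (X * (be + q) - (- q) * Y) + X * (X * q - (be - q) * Y))
    + (- X) * (p * (- Y * (be + q) - (- q) * (- X)) - (al + p) * (X * (be + q) - (- q) * Y) + X * (X * (- X) - (- Y) * Y))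
    - (- Y) * (p * (- Y * q - (be - q) * (- X)) - (al + p) * (X * q - (be - q) * Y) + Y * (X * (- X) - (- Y) * Y))
    = (al * be + (X + Y)\<^sup>2) * (al * be + (X - Y)\<^sup>2) + 4 * p * q * ((X + Y) * (X - Y))"
  by (simp add: algebra_simps power2_eq_square)

text \<open>The mean of the first two diagonal entries of the matrix.\<close>

definition GZ_phase :: "real \<Rightarrow> complex \<Rightarrow> complex \<Rightarrow> real ^ 2 \<Rightarrow> real \<Rightarrow> complex" where
  "GZ_phase E l g x t = GZ_form E l x t - g + 1 / (2 * l)"

text \<open>For \<open>m = 1 / cnj l\<close> the second pair of diagonal entries is \<open>(cnj l)\<^sup>2\<close> times the conjugate of the first, and the cross terms
  satisfy \<open>4 p q (X + Y) (X - Y) = (((X + Y)\<^sup>2 - (X - Y)\<^sup>2) / 2)\<^sup>2\<close>. This completes the square: up to a constant factor, the tau function is the square of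
  \<open>\<bar>al\<bar>\<^sup>2\<close> plus a positive constant, so it has no zeros.\<close>

lemma GZ_tau_single_soliton:
  assumes params: "GZ_params 1 lam gam"
  defines "l \<equiv> lam 1"
  shows "GZ_tau E 1 lam gam x t = (cnj l) ^ 4 * (soliton_Q (1 / l\<^sup>2) (GZ_phase E l (gam 1) x t))\<^sup>2"
proof -
  define g m where "g = gam 1" and "m = 1 / cnj l"
  note quad = GZ_params_quadruple[OF params, of 0, simplified, folded One_nat_def]
  have lam: "lam 1 = l" "lam 2 = - l" "lam 3 = m" "lam 4 = - m"
    using quad by (simp_all add: l_def m_def numeral_eq_Suc)
  have gam: "gam 1 = g" "gam 2 = g - 1 / l" "gam 3 = (cnj l)\<^sup>2 * cnj g" "gam 4 = (cnj l)\<^sup>2 * cnj g - cnj l"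
    using quad by (simp_all add: l_def g_def numeral_eq_Suc)
  have l: "l \<noteq> 0" "cmod l \<noteq> 1"
    using GZ_lam_off_unit_circle[OF params, of 0] by (simp_all add: l_def)
  define al where "al = GZ_phase E l g x t"
  define be where "be = (cnj l)\<^sup>2 * cnj al"
  define p q X Y where "p = 1 / (2 * l)" and "q = cnj l / 2" and "X = 1 / (l - m)" and "Y = 1 / (l + m)"
  have neg: "GZ_form E (- a) x t = GZ_form E a x t" for a
    by (simp add: GZ_form_def)
  have formm: "GZ_form E m x t = (cnj l)\<^sup>2 * cnj (GZ_form E l x t)"
    using l(1) by (simp add: cnj_GZ_form m_def)
  let ?F = "\<lambda>i j. GZ_entry E lam gam x t (Suc i) (Suc j)"
  have idx: "Suc 0 = 1" "Suc 1 = 2" "Suc 2 = 3" "Suc 3 = 4"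
    by simp_all
  have d: "?F 0 0 = al - p" "?F 1 1 = al + p" "?F 2 2 = be - q" "?F 3 3 = be + q"
    unfolding idx GZ_entry_eq lam gam neg formm al_def be_def GZ_phase_def p_def q_def
    using l(1) by (simp_all add: field_simps power2_eq_square)
  have o: "?F 0 1 = p" "?F 1 0 = - p" "?F 2 3 = q" "?F 3 2 = - q"
    "?F 0 2 = X" "?F 0 3 = Y" "?F 1 2 = - Y" "?F 1 3 = - X"
    "?F 2 0 = - X" "?F 2 1 = Y" "?F 3 0 = - Y" "?F 3 1 = X"
    unfolding idx GZ_entry_eq lam p_def q_def X_def Y_def
    using minus_divide_right[of 1 "l + m"] minus_divide_right[of 1 "l - m"]
    by (simp_all add: m_def add.commute)
  have "GZ_tau E 1 lam gam x t = (al * be + (X + Y)\<^sup>2) * (al * be + (X - Y)\<^sup>2) + 4 * p * q * ((X + Y) * (X - Y))"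
    unfolding GZ_tau_def GZ_matrix_def mult_1_right det_mat_4 d o by (rule det_two_pairs)
  also have "\<dots> = (cnj l) ^ 4 * (soliton_Q (1 / l\<^sup>2) al)\<^sup>2"
  proof -
    define k where "k = 1 / l\<^sup>2"
    have k: "k \<noteq> 0" "cmod k \<noteq> 1"
      using l cmod_power2_neq_1[of l] by (simp_all add: k_def norm_divide norm_power)
    have ll: "l\<^sup>2 * (cnj l)\<^sup>2 \<noteq> 1"
    proof
      assume "l\<^sup>2 * (cnj l)\<^sup>2 = 1"
      then have "cmod l * cmod l = 1 \<or> cmod l * cmod l = - 1"
        using arg_cong[of "l\<^sup>2 * (cnj l)\<^sup>2" 1 cmod]
        by (simp add: norm_mult norm_power power2_eq_1_iff flip: power_mult_distrib)
      then show False
        using cmod_power2_neq_1[OF l(2)] zero_le_square[of "cmod l"] by (auto simp: power2_eq_square)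
    qed
    define c W where "c = cnj l" and "W = l\<^sup>2 * c\<^sup>2 - 1"
    have c: "c \<noteq> 0" and W: "W \<noteq> 0" and W_eq: "W = (l * c - 1) * (l * c + 1)"
      using l(1) ll by (simp_all add: c_def W_def algebra_simps power2_eq_square)
    then have f: "l * c - 1 \<noteq> 0" "l * c + 1 \<noteq> 0"
      by auto
    have "X = c / (l * c - 1)" "Y = c / (l * c + 1)"
      using c by (simp_all add: X_def Y_def m_def flip: c_def) (simp_all add: field_simps)
    then have S: "X + Y = 2 * l * c\<^sup>2 / W" and T: "X - Y = 2 * c / W"
      unfolding W_eq using f by (simp_all add: add_frac_eq diff_frac_eq) (simp_all add: algebra_simps power2_eq_square)
    have "(X + Y)\<^sup>2 - (X - Y)\<^sup>2 = 4 * c\<^sup>2 * W / W\<^sup>2"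
      unfolding S T power_divide diff_divide_distrib[symmetric] by (simp add: W_def algebra_simps power2_eq_square)
    then have "(X + Y)\<^sup>2 - (X - Y)\<^sup>2 = 4 * c\<^sup>2 / W"
      using W by (simp add: power2_eq_square)
    moreover have "4 * p * q * ((X + Y) * (X - Y)) = 4 * c ^ 4 / W\<^sup>2"
      unfolding S T p_def q_def using l(1) W by (simp add: power2_eq_square power4_eq_xxxx flip: c_def)
    ultimately have "4 * p * q * ((X + Y) * (X - Y)) = (((X + Y)\<^sup>2 - (X - Y)\<^sup>2) / 2)\<^sup>2"
      by (simp add: power_divide power_mult_distrib flip: power_mult)
    then have "(al * be + (X + Y)\<^sup>2) * (al * be + (X - Y)\<^sup>2) + 4 * p * q * ((X + Y) * (X - Y)) =
        (al * be + ((X + Y)\<^sup>2 + (X - Y)\<^sup>2) / 2)\<^sup>2"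
      by (simp add: field_simps power2_eq_square)
    also have "((X + Y)\<^sup>2 + (X - Y)\<^sup>2) / 2 = (cnj l)\<^sup>2 * of_real (soliton_shift k)"
    proof -
      have "of_real (soliton_shift k) * (1 - k * cnj k)\<^sup>2 = 2 * k * cnj k * (1 + k * cnj k)"
        using k(2) by (rule soliton_shift_rel)
      moreover have W1: "W + 1 \<noteq> 0" and kk: "k * cnj k = 1 / (W + 1)"
        using l(1) by (simp_all add: k_def W_def c_def)
      moreover have "1 - 1 / (W + 1) = W / (W + 1)" "1 + 1 / (W + 1) = (W + 2) / (W + 1)"
        using W1 by (simp_all add: field_simps)
      ultimately have "of_real (soliton_shift k) * (W / (W + 1))\<^sup>2 = 2 * (1 / (W + 1)) * ((W + 2) / (W + 1))"
        by (simp only: mult.assoc[of 2])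
      then have "of_real (soliton_shift k) * W\<^sup>2 / (W + 1)\<^sup>2 = 2 * (W + 2) / (W + 1)\<^sup>2"
        by (simp add: power2_eq_square)
      then have "of_real (soliton_shift k) * W\<^sup>2 = 2 * (W + 2)"
        unfolding divide_cancel_right using W1 by simp
      then have h: "of_real (soliton_shift k) = 2 * (W + 2) / W\<^sup>2"
        using W by (simp add: nonzero_eq_divide_eq)
      have "(2 * l * c\<^sup>2)\<^sup>2 + (2 * c)\<^sup>2 = 4 * c\<^sup>2 * (W + 2)"
        by (simp add: W_def algebra_simps power2_eq_square)
      then have "((X + Y)\<^sup>2 + (X - Y)\<^sup>2) / 2 = c\<^sup>2 * (2 * (W + 2) / W\<^sup>2)"
        unfolding S T power_divide add_divide_distrib[symmetric] by simp
      then show ?thesis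
        by (simp only: h c_def)
    qed
    also have "al * be + (cnj l)\<^sup>2 * of_real (soliton_shift k) = (cnj l)\<^sup>2 * soliton_Q k al"
      by (simp add: be_def soliton_Q_def algebra_simps)
    finally show ?thesis
      by (simp add: k_def power_mult_distrib)
  qed
  finally show ?thesis
    by (simp add: al_def g_def)
qed

lemma GZ_phase_shift:
  assumes "E > 0" "l \<noteq> 0" "zc c = GZ_velocity E l"
  shows "GZ_phase E l g x t = GZ_phase E l g (x - t *\<^sub>R c) 0"
  unfolding GZ_phase_def GZ_form_comoving[OF assms(1,2)] by (simp add: zc_diff zc_scaleR assms(3))

lemma smooth_GZ_phase: "smooth (\<lambda>p. GZ_phase E l g (fst p) (snd p))"
proof -
  have "bounded_linear (\<lambda>p :: (real ^ 2) \<times> real. zc (fst p))"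
    using bounded_linear_compose[OF bounded_linear_zc bounded_linear_fst] .
  moreover have "bounded_linear (\<lambda>p :: (real ^ 2) \<times> real. complex_of_real (snd p))"
    using bounded_linear_compose[OF bounded_linear_of_real bounded_linear_snd] .
  ultimately show ?thesis
    unfolding GZ_phase_def GZ_form_def divide_inverse
    by (intro smooth_add smooth_diff smooth_mult smooth_const smooth_bounded_linear bounded_linear_compose[OF bounded_linear_cnj])
qed

text \<open>The linear part \<open>cnj z - z / l\<^sup>2\<close> has absolute value at least \<open>\<bar>1 - 1 / \<bar>l\<bar>\<^sup>2\<bar> \<bar>z\<bar>\<close>.\<close>

lemma GZ_phase_at_infinity:
  assumes "E > 0" "l \<noteq> 0" "cmod l \<noteq> 1"
  shows "filterlim (\<lambda>x. cmod (GZ_phase E l g x t)) at_top at_infinity"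
proof -
  define e where "e = E powr (1/2) / 2"
  define M where "M = cmod (GZ_phase E l g 0 t)"
  define d where "d = \<bar>1 - 1 / (cmod l)\<^sup>2\<bar>"
  have "e > 0" "d > 0"
    using assms cmod_power2_neq_1[of l] by (simp_all add: e_def d_def)
  have lower: "e * d * norm x - M \<le> cmod (GZ_phase E l g x t)" for x
  proof -
    have "GZ_phase E l g x t = \<i> * of_real e * (cnj (zc x) - zc x / l\<^sup>2) + GZ_phase E l g 0 t"
      by (simp add: GZ_phase_def GZ_form_def e_def zc_zero)
    then have "cmod (\<i> * of_real e * (cnj (zc x) - zc x / l\<^sup>2)) \<le> cmod (GZ_phase E l g x t) + M"
      using norm_triangle_ineq4[of "GZ_phase E l g x t" "GZ_phase E l g 0 t"] by (simp add: M_def)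
    moreover have "d * norm x \<le> cmod (cnj (zc x) - zc x / l\<^sup>2)"
    proof -
      have "cmod (cnj (zc x)) - cmod (zc x / l\<^sup>2) = (1 - 1 / (cmod l)\<^sup>2) * norm x"
        by (simp add: norm_divide norm_power norm_zc left_diff_distrib)
      then have "d * norm x = \<bar>cmod (cnj (zc x)) - cmod (zc x / l\<^sup>2)\<bar>"
        by (simp add: d_def abs_mult)
      then show ?thesis
        using norm_triangle_ineq3 by metis
    qed
    then have "e * (d * norm x) \<le> e * cmod (cnj (zc x) - zc x / l\<^sup>2)"
      using \<open>e > 0\<close> by (intro mult_left_mono) simp_all
    moreover have "cmod (\<i> * of_real e * (cnj (zc x) - zc x / l\<^sup>2)) = e * cmod (cnj (zc x) - zc x / l\<^sup>2)"
      using \<open>e > 0\<close> by (simp add: norm_mult)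
    ultimately show ?thesis
      unfolding mult.assoc by linarith
  qed
  have "filterlim (\<lambda>x :: real ^ 2. - M + e * d * norm x) at_top at_infinity"
    using \<open>e > 0\<close> \<open>d > 0\<close>
    by (intro filterlim_tendsto_add_at_top[OF tendsto_const] filterlim_tendsto_pos_mult_at_top[OF tendsto_const]
        filterlim_norm_at_top) simp_all
  then show ?thesis
    by (rule filterlim_at_top_mono) (use lower in \<open>simp add: algebra_simps\<close>)
qed

text \<open>Replacing the real time by a complex variable makes the potential a rational function, to which the rules for complex
  derivatives apply; conjugates become the independent affine function \<open>cnj a + s cnj T\<close>.\<close>

lemma soliton_v_time_derivative:
  fixes a T :: complex and k :: complex
  assumes "k \<noteq> 0" "cmod k \<noteq> 1"
  defines "al \<equiv> \<lambda>s. a + of_real s * T"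
  shows "((\<lambda>s. soliton_v k (al s)) has_vector_derivative
    16 * (k * cnj (al t) * cnj T + cnj k * al t * T) * (1 / soliton_Q k (al t)) ^ 2
    - 2 * soliton_num k (al t) * (al t * cnj T + cnj (al t) * T) * (1 / soliton_Q k (al t)) ^ 3) (at t)"
proof -
  let ?h = "complex_of_real (soliton_shift k)"
  let ?A = "\<lambda>s. a + s * T" and ?B = "\<lambda>s. cnj a + s * cnj T"
  let ?Q = "\<lambda>s. ?A s * ?B s + ?h"
  let ?N = "\<lambda>s. 8 * (k * (?B s)\<^sup>2 + cnj k * (?A s)\<^sup>2 - ?h * (1 + k * cnj k))"
  have Q: "soliton_Q k (al s) = ?Q (of_real s)" and N: "soliton_num k (al s) = ?N (of_real s)" for s
    by (simp_all add: soliton_Q_def soliton_num_def al_def)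
  have Qnz: "?Q (of_real t) \<noteq> 0"
    unfolding Q[symmetric] using soliton_Q_nonzero[OF soliton_shift_pos[OF assms(1,2)]] .
  have quot: "((\<lambda>s. f s / (q s)\<^sup>2) has_field_derivative f' * (1 / q z) ^ 2 - 2 * f z * q' * (1 / q z) ^ 3) (at z)"
    if "(f has_field_derivative f') (at z)" "(q has_field_derivative q') (at z)" "q z \<noteq> 0" for f q :: "complex \<Rightarrow> complex" and f' q' z
    using that by (auto intro!: derivative_eq_intros simp: field_simps power2_eq_square power3_eq_cube)
  have "((\<lambda>s. ?N s / (?Q s)\<^sup>2) has_field_derivative
      16 * (k * ?B (of_real t) * cnj T + cnj k * ?A (of_real t) * T) * (1 / ?Q (of_real t)) ^ 2
      - 2 * ?N (of_real t) * (?A (of_real t) * cnj T + ?B (of_real t) * T) * (1 / ?Q (of_real t)) ^ 3) (at (of_real t))"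
    by (rule quot) (use Qnz in \<open>auto intro!: derivative_eq_intros simp: algebra_simps\<close>)
  from has_vector_derivative_real_field[OF this] show ?thesis
    by (simp add: soliton_v_def Q N) (simp add: al_def)
qed

text \<open>With \<open>e = E powr (1/2) / 2\<close> all powers of \<open>E\<close> become polynomial in \<open>e\<close>, and the pair is \<open>e\<^sup>2\<close> times the normalised soliton evaluated at the phase.
  The phase depends on \<open>(x, t)\<close> only through \<open>x - t c\<close>.\<close>

lemma GZ_single_soliton_solution:
  assumes E: "E > 0" and params: "GZ_params 1 lam gam"
  shows "NV_solution E (GZ_v E 1 lam gam) (GZ_w E 1 lam gam)"
    and "zc c = GZ_velocity E (lam 1) \<Longrightarrow> travels_with (GZ_v E 1 lam gam) (GZ_w E 1 lam gam) c"
proof -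
  define l k e D where "l = lam 1" and "k = 1 / l\<^sup>2" and "e = E powr (1/2) / 2" and "D = - \<i> * complex_of_real e"
  define a where "a = GZ_phase E l (gam 1)"
  have l: "l \<noteq> 0" "cmod l \<noteq> 1"
    using GZ_lam_off_unit_circle[OF params, of 0] by (simp_all add: l_def)
  have k: "k \<noteq> 0" "cmod k \<noteq> 1"
    using l cmod_power2_neq_1[of l] by (simp_all add: k_def norm_divide norm_power)
  have "E powr (1/2) * E powr (1/2) = E"
    using E by (simp flip: powr_add)
  then have E4: "E = 4 * e\<^sup>2"
    by (simp add: e_def power2_eq_square)
  have E8: "E powr (3/2) = 8 * e ^ 3"
    unfolding powr_three_halves[OF E] by (subst E4) (simp add: e_def power2_eq_square power3_eq_cube)
  have E2: "E powr (1/2) = 2 * e"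
    by (simp add: e_def)
  have D2: "- D\<^sup>2 = (of_real e)\<^sup>2"
    by (simp add: D_def power_mult_distrib)
  have a_eq: "a x t = (D * k * zc x + - D * cnj (zc x)) + (of_real t * (24 * D * (of_real e)\<^sup>2 * (1 / k - k\<^sup>2)) + (1 / (2 * l) - gam 1))" for x t
    by (simp add: a_def GZ_phase_def GZ_form_def E2 E8 D_def k_def power_divide algebra_simps power2_eq_square power3_eq_cube power4_eq_xxxx)
  have soliton: "soliton k D (\<lambda>x. a x t)" for t
  proof
    show "has_wirtinger (\<lambda>x. a x t) (D * k) (- D) x" for x
    proof -
      have "has_wirtinger (\<lambda>x. (D * k * zc x + - D * cnj (zc x)) + (of_real t * (24 * D * (of_real e)\<^sup>2 * (1 / k - k\<^sup>2)) + (1 / (2 * l) - gam 1)))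
          ((D * k * 1 + - D * 0) + 0) ((D * k * 0 + - D * 1) + 0) x"
        by (intro has_wirtinger_add has_wirtinger_cmult has_wirtinger_zc has_wirtinger_cnj_zc has_wirtinger_const)
      then show ?thesis
        unfolding a_eq by simp
    qed
  qed (use k in \<open>simp_all add: D_def\<close>)
  have tau: "Determinant.det (GZ_matrix E 1 lam gam y t) = (cnj l) ^ 4 * (soliton.Q k (\<lambda>x. a x t) y)\<^sup>2" for y t
    unfolding soliton.Q_def[OF soliton] using GZ_tau_single_soliton[OF params, of E y t]
    by (simp only: GZ_tau_def a_def k_def l_def)
  have v: "GZ_v E 1 lam gam x t = (of_real e)\<^sup>2 * soliton_v k (a x t)"
    and w: "GZ_w E 1 lam gam x t = (of_real e)\<^sup>2 * soliton_w k (a x t)" for x t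
    using soliton.log_derivatives_square[OF soliton, of "(cnj l) ^ 4" t x] l(1)
    unfolding GZ_v_def GZ_w_def tau D2 by simp_all
  show "travels_with (GZ_v E 1 lam gam) (GZ_w E 1 lam gam) c" if "zc c = GZ_velocity E (lam 1)"
  proof -
    have shift: "a x t = a (x - t *\<^sub>R c) 0" for x t
      unfolding a_def using that by (intro GZ_phase_shift[OF E l(1)]) (simp only: l_def)
    show ?thesis
      unfolding travels_with_def v w
    proof (intro exI allI conjI)
      fix x t
      show "(of_real e)\<^sup>2 * soliton_v k (a x t) = (\<lambda>y. (of_real e)\<^sup>2 * soliton_v k (a y 0)) (x - t *\<^sub>R c)"
        "(of_real e)\<^sup>2 * soliton_w k (a x t) = (\<lambda>y. (of_real e)\<^sup>2 * soliton_w k (a y 0)) (x - t *\<^sub>R c)"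
        by (simp_all only: shift[of x t])
    qed
  qed
  have smooth: "smooth (\<lambda>(x, t). GZ_v E 1 lam gam x t)" "smooth (\<lambda>(x, t). GZ_w E 1 lam gam x t)"
    unfolding v w case_prod_beta a_def by (intro smooth_mult smooth_const smooth_soliton k smooth_GZ_phase)+
  have decay: "((\<lambda>x. GZ_v E 1 lam gam x t) \<longlongrightarrow> 0) at_infinity" "((\<lambda>x. GZ_w E 1 lam gam x t) \<longlongrightarrow> 0) at_infinity" for t
    using soliton_tendsto_0[OF k GZ_phase_at_infinity[OF E l, of "gam 1" t]]
    unfolding v w a_def by (auto intro: tendsto_mult_right_zero)
  have real: "GZ_v E 1 lam gam x t = cnj (GZ_v E 1 lam gam x t)" for x t
    unfolding v by (simp add: cnj_soliton_v)
  have evolution: "vector_derivative (\<lambda>s. GZ_v E 1 lam gam x s) (at t) =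
      of_real (4 * Re (4 * d_z (d_z (d_z (\<lambda>y. GZ_v E 1 lam gam y t))) x
        + d_z (\<lambda>y. GZ_v E 1 lam gam y t * GZ_w E 1 lam gam y t) x
        - of_real E * d_z (\<lambda>y. GZ_w E 1 lam gam y t) x))" for x t
  proof -
    define T where "T = 24 * D * (of_real e)\<^sup>2 * (1 / k - k\<^sup>2)"
    have a_line: "a x s = a x 0 + of_real s * T" for s
      by (simp add: a_eq T_def)
    let ?r = "1 / soliton_Q k (a x t)"
    have "((\<lambda>s. soliton_v k (a x s)) has_vector_derivative
        16 * (k * cnj (a x t) * cnj T + cnj k * a x t * T) * ?r ^ 2
        - 2 * soliton_num k (a x t) * (a x t * cnj T + cnj (a x t) * T) * ?r ^ 3) (at t)"
      using soliton_v_time_derivative[OF k, of "a x 0" T t] unfolding a_line[symmetric] .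
    from has_vector_derivative_mult_right[OF this, of "(of_real e)\<^sup>2"]
    have "vector_derivative (\<lambda>s. GZ_v E 1 lam gam x s) (at t) = (of_real e)\<^sup>2 *
        (16 * (k * cnj (a x t) * cnj T + cnj k * a x t * T) * ?r ^ 2
        - 2 * soliton_num k (a x t) * (a x t * cnj T + cnj (a x t) * T) * ?r ^ 3)"
      unfolding v by (rule vector_derivative_at)
    also have "\<dots> = of_real (4 * Re (4 * d_z (d_z (d_z (\<lambda>y. GZ_v E 1 lam gam y t))) x
        + d_z (\<lambda>y. GZ_v E 1 lam gam y t * GZ_w E 1 lam gam y t) x
        - of_real (4 * e\<^sup>2) * d_z (\<lambda>y. GZ_w E 1 lam gam y t) x))"
      unfolding v w soliton.evolution[OF soliton D_def]
      by (simp only: soliton.B_def[OF soliton] soliton.r_def[OF soliton] soliton.Q_def[OF soliton] soliton.n_def[OF soliton] T_def)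
    finally show ?thesis
      by (simp only: E4[symmetric])
  qed
  have dbar: "d_zbar (\<lambda>y. GZ_w E 1 lam gam y t) x = - 3 * d_z (\<lambda>y. GZ_v E 1 lam gam y t) x" for x t
  proof -
    interpret soliton k D "\<lambda>x. a x t"
      by (rule soliton)
    have scale: "d_z (\<lambda>y. c * f y) x = c * d_z f x" "d_zbar (\<lambda>y. c * f y) x = c * d_zbar f x"
      if "has_wirtinger f p q x" for c f p q
      using has_wirtinger_imp[OF that] has_wirtinger_imp[OF has_wirtinger_cmult[OF that]] by simp_all
    have sm: "smooth (\<lambda>y. a y t)"
      unfolding a_eq
      by (intro smooth_add smooth_mult smooth_const smooth_bounded_linear bounded_linear_zc
          bounded_linear_compose[OF bounded_linear_cnj bounded_linear_zc])
    show ?thesis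
      unfolding v w scale(1)[OF smooth_imp_has_wirtinger[OF smooth_soliton(1)[OF k sm]]]
        scale(2)[OF smooth_imp_has_wirtinger[OF smooth_soliton(2)[OF k sm]]]
      using d_zbar_w[of x] by (simp add: v_eq w_eq)
  qed
  show "NV_solution E (GZ_v E 1 lam gam) (GZ_w E 1 lam gam)"
    unfolding NV_solution_def using smooth decay real evolution dbar by blast
qed

section \<open>Travel waves\<close>

theorem lemma2p1:
  fixes E :: real and N :: nat and lam gam :: "nat \<Rightarrow> complex"
    and v w :: "real ^ 2 \<Rightarrow> real \<Rightarrow> complex"
  assumes "E > 0" and "N \<ge> 1" and "GZ_params N lam gam"
    and "v = GZ_v E N lam gam" and "w = GZ_w E N lam gam"
  shows "((\<exists>c. travels_with v w c) \<longleftrightarrow> N = 1)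
    \<and> ((\<exists>c. NV_travel_wave E v w c) \<longleftrightarrow> N = 1)
    \<and> (N = 1 \<longrightarrow>
        (\<forall>c. travels_with v w c \<longrightarrow>
          (\<forall>j\<in>{1..4}. zc c = 6 * of_real E *
             ((cnj (lam j))\<^sup>2 + 1 / (lam j)\<^sup>2 + (lam j)\<^sup>2 / (cnj (lam j))\<^sup>2)))
        \<and> (\<forall>lam' gam'. GZ_params 1 lam' gam' \<longrightarrow>
             (\<exists>j\<in>{1..4}. \<exists>k\<in>{1..4}. lam' k = lam j) \<longrightarrow>
             lam' ` {1..4} = lam ` {1..4}))"
proof -
  have only_1: "N = 1" if "travels_with v w c" for c
    using travelling_imp_N_eq_1 assms that by blast
  obtain c where c: "zc c = GZ_velocity E (lam 1)"
    using zc_surj by blast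
  have wave: "NV_travel_wave E v w c" if "N = 1"
    using GZ_single_soliton_solution[OF assms(1)] assms(3-5) c that unfolding NV_travel_wave_def by blast
  have velocity: "zc d = 6 * of_real E * ((cnj (lam j))\<^sup>2 + 1 / (lam j)\<^sup>2 + (lam j)\<^sup>2 / (cnj (lam j))\<^sup>2)"
    if "N = 1" "travels_with v w d" "j \<in> {1..4}" for d j
  proof -
    have "j - 1 < 4 * N" "Suc (j - 1) = j"
      using that by auto
    then show ?thesis
      using travelling_velocity[of E N lam gam d "j - 1"] assms that(2) by (simp add: GZ_velocity_def)
  qed
  have image: "\<mu> ` {1..4} = (\<lambda>z. {z, - z, 1 / cnj z, - (1 / cnj z)}) (\<mu> j)"
    if "GZ_params 1 \<mu> \<delta>" "j \<in> {1..4}" for \<mu> \<delta> :: "nat \<Rightarrow> complex" and j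
  proof -
    have set: "{1..4} = {1, 2, 3, 4 :: nat}"
      by auto
    note quad = GZ_params_quadruple[OF that(1), of 0, simplified, folded One_nat_def]
    have "\<mu> 2 = - \<mu> 1" "\<mu> 3 = 1 / cnj (\<mu> 1)" "\<mu> 4 = - (1 / cnj (\<mu> 1))"
      using quad by (simp_all add: numeral_eq_Suc)
    with that(2) show ?thesis
      unfolding set by auto
  qed
  have "lam' ` {1..4} = lam ` {1..4}"
    if "N = 1" and params': "GZ_params 1 lam' gam'" and common: "\<exists>j\<in>{1..4}. \<exists>k\<in>{1..4}. lam' k = lam j" for lam' gam'
  proof -
    obtain j k where jk: "j \<in> {1..4}" "k \<in> {1..4}" "lam' k = lam j"
      using common by blast
    have "GZ_params 1 lam gam"
      using assms(3) \<open>N = 1\<close> by simp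
    from image[OF this jk(1)] image[OF params' jk(2)] show ?thesis
      by (simp only: jk(3))
  qed
  moreover have "(\<exists>c. travels_with v w c) \<longleftrightarrow> N = 1"
    using only_1 wave unfolding NV_travel_wave_def by blast
  moreover have "(\<exists>c. NV_travel_wave E v w c) \<longleftrightarrow> N = 1"
    using only_1 wave unfolding NV_travel_wave_def by blast
  ultimately show ?thesis
    using velocity by blast
qed

end
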